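(* The triple $(\mathbf{nnfp},\mu,\Delta)$ defines a Hopf submonoid of $(\mathbf{scfp},\mu,\Delta)$.
   Context: Pattern groups: $\mathbb{F}_q$ is the field with $q$ elements. For a poset $\mathcal{P}$ on a finite set $I$, $\mathfrak{u}_\mathcal{P}$ is the algebra of matrices $x=(x_{ij})_{i,j\in I}$ over $\mathbb{F}_q$ with $x_{ij}=0$ unless $i\prec_\mathcal{P}j$, and $U_\mathcal{P}=\{1+x\mid x\in\mathfrak{u}_\mathcal{P}\}$ with matrix multiplication; $f(1+x)=x$. Let $\mathbf{f}(X)$ denote the space of functions $X\to\mathbb{C}$; for finite $X,Y$ identify $\mathbf{f}(X)\otimes\mathbf{f}(Y)$ with $\mathbf{f}(X\times Y)$ via $(\alpha\otimes\beta)(x,y)=\alpha(x)\beta(y)$. Hopf monoids: a vector species is a functor $\mathbf{p}$ from finite sets with bijections to complex vector spaces; it is connected if $\mathbf{p}[\emptyset]=\mathbb{C}$. A Hopf monoid is a connected species $\mathbf{p}$ with linear maps $\mu_{S,T}:\mathbf{p}[S]\otimes\mathbf{p}[T]\to\mathbf{p}[S\sqcup T]$ and $\Delta_{S,T}:\mathbf{p}[S\sqcup T]\to\mathbf{p}[S]\otimes\mathbf{p}[T]$ for all disjoint finite sets $S,T$ such that: (i) they are natural in bijections $\sigma:S\to S'$, $\tau:T\to T'$; (ii) $\mu_{R\sqcup S,T}(\mu_{R,S}\otimes\mathrm{id})=\mu_{R,S\sqcup T}(\mathrm{id}\otimes\mu_{S,T})$; (iii) $(\Delta_{R,S}\otimes\mathrm{id})\Delta_{R\sqcup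 S,T}=(\mathrm{id}\otimes\Delta_{S,T})\Delta_{R,S\sqcup T}$; (iv) if $S_1\sqcup S_2=T_1\sqcup T_2=I$ and $A=S_1\cap T_1$, $B=S_1\cap T_2$, $C=S_2\cap T_1$, $D=S_2\cap T_2$, then $\Delta_{T_1,T_2}\mu_{S_1,S_2}=(\mu_{A,C}\otimes\mu_{B,D})\circ\mathrm{swap}\circ(\Delta_{A,B}\otimes\Delta_{C,D})$, where swap exchanges the two middle tensor factors; (v) $\mu_{S,\emptyset},\mu_{\emptyset,S},\Delta_{S,\emptyset},\Delta_{\emptyset,S}$ are the canonical identifications. A Hopf submonoid is a subspecies to which $\mu$ and $\Delta$ restrict and which is a Hopf monoid under these restrictions. The Hopf monoid $(\mathbf{fp},\mu,\Delta)$: $\mathbf{fp}[I]=\bigoplus_{\mathcal{P}}\mathbf{f}(U_\mathcal{P})$ over all posets $\mathcal{P}$ on $I$; a bijection $\sigma:I\to J$ acts via the relabeling isomorphism $U_{\sigma\mathcal{P}}\cong U_\mathcal{P}$, where $\sigma\mathcal{P}$ is the poset on $J$ with $\sigma(i)\prec\sigma(j)$ iff $i\prec_\mathcal{P}j$. For posets $\mathcal{P}$ on $S$ and $\mathcal{Q}$ on $T$ ($S,T$ disjoint), $\mathcal{P}\cdot\mathcal{Q}$ is the poset on $S\sqcup T$ extending $\mathcal{P}$ and $\mathcal{Q}$ with every element of $S$ below every element of $T$ (and no further relations). The homomorphism $\pi_{\mathcal{P},\mathcal{Q}}:U_{\mathcal{P}\cdot\mathcal{Q}}\to U_\mathcal{P}\times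 U_\mathcal{Q}$ is $g\mapsto(g_S,g_T)$ (diagonal blocks), and $\mu_{S,T}$ is the linear extension of $\alpha\otimes\beta\mapsto(\alpha\otimes\beta)\circ\pi_{\mathcal{P},\mathcal{Q}}$ for $\alpha\in\mathbf{f}(U_\mathcal{P})$, $\beta\in\mathbf{f}(U_\mathcal{Q})$. For a poset $\mathcal{P}$ on $S\sqcup T$ with restrictions $\mathcal{P}|_S,\mathcal{P}|_T$, $\sigma_{\mathcal{P}|_S,\mathcal{P}|_T}:U_{\mathcal{P}|_S}\times U_{\mathcal{P}|_T}\to U_\mathcal{P}$ sends $(g,h)$ to the matrix with entries $g_{ij}$ for $i,j\in S$, $h_{ij}$ for $i,j\in T$, $0$ otherwise, and $\Delta_{S,T}$ is the linear extension of $\alpha\mapsto\alpha\circ\sigma_{\mathcal{P}|_S,\mathcal{P}|_T}\in\mathbf{f}(U_{\mathcal{P}|_S})\otimes\mathbf{f}(U_{\mathcal{P}|_T})$ for $\alpha\in\mathbf{f}(U_\mathcal{P})$. Subspecies: $\mathbf{scf}(U_\mathcal{P})$ is the space of functions on $U_\mathcal{P}$ that are constant on each algebra group superclass $\{h\in U_\mathcal{P}\mid f(h)\in U_\mathcal{P}f(g)U_\mathcal{P}\}$, $g\in U_\mathcal{P}$. For $g\in U_\mathcal{P}$, $\mathrm{sml}(g)$ is the set of labeled arcs $i\overset{g_{ij}}{\frown}j$ with $i\prec_\mathcal{P}j$, $g_{ij}\neq0$, and $g_{kl}=0$ whenever $(k,l)\neq(i,j)$ and $i\preceq_\mathcal{P}k\prec_\mathcal{P}l\preceq_\mathcal{P}j$.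 $\mathbf{nnf}(U_\mathcal{P})$ is the space of functions on $U_\mathcal{P}$ constant on the nonnesting superclasses, i.e. functions $\alpha$ with $\alpha(g)=\alpha(h)$ whenever $\mathrm{sml}(g)=\mathrm{sml}(h)$. Then $\mathbf{scfp}[I]=\bigoplus_\mathcal{P}\mathbf{scf}(U_\mathcal{P})$ and $\mathbf{nnfp}[I]=\bigoplus_\mathcal{P}\mathbf{nnf}(U_\mathcal{P})$, sums over all posets $\mathcal{P}$ on $I$, with $\mu$ and $\Delta$ the restrictions of those of $\mathbf{fp}$. *)

theory Defs
  imports Complex_Main "HOL-Library.Function_Algebras"
begin

section \<open>Tensor products of spaces of complex functions\<close>

text \<open>
  Every complex vector space occurring below is given as a linear subspace of the space of all
  functions from some index type to the complex numbers. This is no loss of generality (every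
  vector space embeds into a space of functions on a set), and it realises the identification of
  \<open>f(X) \<otimes> f(Y)\<close> with \<open>f(X \<times> Y)\<close>: for subspaces \<open>V\<close> and \<open>W\<close> of function spaces,
  the map sending \<open>v \<otimes> w\<close> to \<open>(x, y) \<mapsto> v x * w y\<close> is injective on \<open>V \<otimes> W\<close>.
\<close>

definition cscale :: "complex \<Rightarrow> ('b \<Rightarrow> complex) \<Rightarrow> 'b \<Rightarrow> complex" where
  "cscale c v = (\<lambda>x. c * v x)"

global_interpretation cfun: vector_space cscale
  by unfold_locales (simp_all add: cscale_def fun_eq_iff algebra_simps)

definition lin_map ::
  "('b \<Rightarrow> complex) set \<Rightarrow> ('c \<Rightarrow> complex) set \<Rightarrow> (('b \<Rightarrow> complex) \<Rightarrow> ('c \<Rightarrow> complex)) \<Rightarrow> bool" where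
  "lin_map V W f \<longleftrightarrow>
     (\<forall>v\<in>V. f v \<in> W) \<and>
     (\<forall>v\<in>V. \<forall>w\<in>V. f (v + w) = f v + f w) \<and>
     (\<forall>c. \<forall>v\<in>V. f (cscale c v) = cscale c (f v))"

definition pure_tensor :: "('b \<Rightarrow> complex) \<Rightarrow> ('c \<Rightarrow> complex) \<Rightarrow> 'b \<times> 'c \<Rightarrow> complex"
  (infixr "\<otimes>\<^sub>v" 72) where
  "v \<otimes>\<^sub>v w = (\<lambda>(x, y). v x * w y)"

definition tensor ::
  "('b \<Rightarrow> complex) set \<Rightarrow> ('c \<Rightarrow> complex) set \<Rightarrow> ('b \<times> 'c \<Rightarrow> complex) set"
  (infixr "\<otimes>\<^sub>s" 72) where
  "V \<otimes>\<^sub>s W = cfun.span {v \<otimes>\<^sub>v w | v w. v \<in> V \<and> w \<in> W}"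

text \<open>
  The tensor product of linear maps \<open>\<phi>\<close> on \<open>V\<close> and \<open>\<psi>\<close> on \<open>W\<close> applies \<open>\<psi>\<close> to the slices of a tensor
  in its second argument and then \<open>\<phi>\<close> to the slices in its first argument. The lemmas
  \<open>tensor_map_pure\<close> and \<open>lin_map_tensor_map\<close> show that on \<open>V \<otimes>\<^sub>s W\<close> this is the linear map
  determined by sending \<open>v \<otimes>\<^sub>v w\<close> to \<open>\<phi> v \<otimes>\<^sub>v \<psi> w\<close>.
\<close>

definition tensor_map ::
  "(('b \<Rightarrow> complex) \<Rightarrow> ('d \<Rightarrow> complex)) \<Rightarrow> (('c \<Rightarrow> complex) \<Rightarrow> ('e \<Rightarrow> complex)) \<Rightarrow>
   ('b \<times> 'c \<Rightarrow> complex) \<Rightarrow> ('d \<times> 'e \<Rightarrow> complex)"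
  (infixr "\<otimes>\<^sub>m" 72) where
  "(\<phi> \<otimes>\<^sub>m \<psi>) t = (\<lambda>(x', y'). \<phi> (\<lambda>x. \<psi> (\<lambda>y. t (x, y)) y') x')"

definition tensor_assoc :: "(('b \<times> 'c) \<times> 'd \<Rightarrow> complex) \<Rightarrow> ('b \<times> ('c \<times> 'd) \<Rightarrow> complex)" where
  "tensor_assoc t = (\<lambda>(x, (y, z)). t ((x, y), z))"

definition tensor_swap ::
  "(('a \<times> 'b) \<times> ('c \<times> 'd) \<Rightarrow> complex) \<Rightarrow> (('a \<times> 'c) \<times> ('b \<times> 'd) \<Rightarrow> complex)" where
  "tensor_swap t = (\<lambda>((a, c), (b, d)). t ((a, b), (c, d)))"

lemma tensor_map_pure:
  assumes "lin_map V V' \<phi>" "lin_map W W' \<psi>" "v \<in> V" "w \<in> W"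
  shows "(\<phi> \<otimes>\<^sub>m \<psi>) (v \<otimes>\<^sub>v w) = \<phi> v \<otimes>\<^sub>v \<psi> w"
proof -
  have 1: "\<psi> (\<lambda>y. v x * w y) = (\<lambda>y. v x * \<psi> w y)" for x
    using assms(2,4) unfolding lin_map_def cscale_def by blast
  have 2: "\<phi> (\<lambda>x. v x * c) = (\<lambda>x. c * \<phi> v x)" for c
  proof -
    have "\<phi> (\<lambda>x. c * v x) = (\<lambda>x. c * \<phi> v x)"
      using assms(1,3) unfolding lin_map_def cscale_def by blast
    thus ?thesis by (simp add: mult.commute)
  qed
  show ?thesis
    by (auto simp: tensor_map_def pure_tensor_def 1 2 mult.commute)
qed

lemma lin_map_tensor_map:
  fixes V :: "('b \<Rightarrow> complex) set" and W :: "('c \<Rightarrow> complex) set"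
  assumes V: "cfun.subspace V" and W: "cfun.subspace W"
    and phi: "lin_map V V' \<phi>" and psi: "lin_map W W' \<psi>"
  shows "lin_map (V \<otimes>\<^sub>s W) (V' \<otimes>\<^sub>s W') (\<phi> \<otimes>\<^sub>m \<psi>)"
proof -
  define r where "r t x = (\<lambda>y. t (x, y))" for t :: "'b \<times> 'c \<Rightarrow> complex" and x
  define l where "l t y' = (\<lambda>x. \<psi> (r t x) y')" for t y'
  have tm: "(\<phi> \<otimes>\<^sub>m \<psi>) t = (\<lambda>(x', y'). \<phi> (l t y') x')" for t
    by (simp add: tensor_map_def l_def r_def)
  have pa: "\<And>v w. v \<in> V \<Longrightarrow> w \<in> V \<Longrightarrow> \<phi> (v + w) = \<phi> v + \<phi> w"
    and pc: "\<And>c v. v \<in> V \<Longrightarrow> \<phi> (cscale c v) = cscale c (\<phi> v)"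
    and qa: "\<And>v w. v \<in> W \<Longrightarrow> w \<in> W \<Longrightarrow> \<psi> (v + w) = \<psi> v + \<psi> w"
    and qc: "\<And>c v. v \<in> W \<Longrightarrow> \<psi> (cscale c v) = cscale c (\<psi> v)"
    using phi psi by (auto simp: lin_map_def)
  have ra: "r (s + t) x = r s x + r t x" for s t x by (auto simp: r_def)
  have rc: "r (cscale c t) x = cscale c (r t x)" for c t x by (auto simp: r_def cscale_def)
  have la: "l (s + t) y' = l s y' + l t y'" if "\<And>x. r s x \<in> W" "\<And>x. r t x \<in> W" for s t y'
    using that by (auto simp: l_def ra qa)
  have lc: "l (cscale c t) y' = cscale c (l t y')" if "\<And>x. r t x \<in> W" for c t y'
    using that unfolding l_def rc by (subst qc) (auto simp: cscale_def)
  define G where "G t \<longleftrightarrow> (\<forall>x. r t x \<in> W) \<and> (\<forall>y'. l t y' \<in> V)" for t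
  have add: "(\<phi> \<otimes>\<^sub>m \<psi>) (s + t) = (\<phi> \<otimes>\<^sub>m \<psi>) s + (\<phi> \<otimes>\<^sub>m \<psi>) t" if "G s" "G t" for s t
    using that by (auto simp: tm G_def la pa fun_eq_iff)
  have scl: "(\<phi> \<otimes>\<^sub>m \<psi>) (cscale c t) = cscale c ((\<phi> \<otimes>\<^sub>m \<psi>) t)" if "G t" for c t
    using that unfolding tm G_def by (auto simp: lc pc fun_eq_iff) (auto simp: cscale_def)
  have main: "G t \<and> (\<phi> \<otimes>\<^sub>m \<psi>) t \<in> V' \<otimes>\<^sub>s W'" if t: "t \<in> V \<otimes>\<^sub>s W" for t
    using t unfolding tensor_def[of V W]
  proof (induction rule: cfun.span_induct_alt)
    case base
    have *: "r 0 x = 0" for x by (auto simp: r_def)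
    have "\<psi> 0 = 0"
      using qc[of 0 0] cfun.subspace_0[OF W] by (simp add: cscale_def fun_eq_iff flip: zero_fun_def)
    hence **: "l 0 y' = 0" for y' by (auto simp: l_def *)
    have "\<phi> 0 = 0"
      using pc[of 0 0] cfun.subspace_0[OF V] by (simp add: cscale_def fun_eq_iff flip: zero_fun_def)
    hence "(\<phi> \<otimes>\<^sub>m \<psi>) 0 = 0" by (auto simp: tm ** fun_eq_iff)
    thus ?case
      by (auto simp: G_def * ** cfun.subspace_0[OF V] cfun.subspace_0[OF W] tensor_def cfun.span_zero
          simp flip: zero_fun_def)
  next
    case (step c b t)
    then obtain v w where b: "b = v \<otimes>\<^sub>v w" "v \<in> V" "w \<in> W" by auto
    have rb: "r b x = cscale (v x) w" for x
      by (auto simp: r_def b pure_tensor_def cscale_def)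
    have lb: "l b y' = cscale (\<psi> w y') v" for y'
      unfolding l_def rb qc[OF b(3)] by (simp add: cscale_def mult.commute)
    have Gb: "G b"
      unfolding G_def rb lb using b(2,3) by (auto intro: cfun.subspace_scale V W)
    have Gcb: "G (cscale c b)"
      using Gb by (auto simp: G_def rc lc intro: cfun.subspace_scale V W)
    have "(\<phi> \<otimes>\<^sub>m \<psi>) b = \<phi> v \<otimes>\<^sub>v \<psi> w"
      unfolding b by (rule tensor_map_pure[OF phi psi b(2,3)])
    hence "(\<phi> \<otimes>\<^sub>m \<psi>) b \<in> V' \<otimes>\<^sub>s W'"
      using b phi psi unfolding tensor_def lin_map_def by (auto intro!: cfun.span_base)
    moreover have "G (cscale c b + t)"
      using Gcb step by (auto simp: G_def ra la intro: cfun.subspace_add V W)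
    moreover have "(\<phi> \<otimes>\<^sub>m \<psi>) (cscale c b + t) = cscale c ((\<phi> \<otimes>\<^sub>m \<psi>) b) + (\<phi> \<otimes>\<^sub>m \<psi>) t"
      using step Gb Gcb by (simp only: add scl)
    ultimately have "G (cscale c b + t) \<and> (\<phi> \<otimes>\<^sub>m \<psi>) (cscale c b + t) \<in> V' \<otimes>\<^sub>s W'"
      using step unfolding tensor_def by (simp only: cfun.span_add cfun.span_scale simp_thms)
    thus ?case by (simp add: plus_fun_def)
  qed
  show ?thesis
    unfolding lin_map_def using main add scl by blast
qed


section \<open>Hopf monoids in vector species\<close>

text \<open>
  Finite sets are the finite subsets of an arbitrary type \<open>'a\<close>. A bijection from \<open>I\<close> onto another
  finite set is a function that is injective on \<open>I\<close>, considered up to its values on \<open>I\<close> only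
  (\<open>act_cong\<close>); its codomain is the image of \<open>I\<close>.
\<close>

locale vector_species =
  fixes p :: "'a set \<Rightarrow> ('b \<Rightarrow> complex) set"
    and act :: "'a set \<Rightarrow> ('a \<Rightarrow> 'a) \<Rightarrow> ('b \<Rightarrow> complex) \<Rightarrow> ('b \<Rightarrow> complex)"
  assumes subspace: "finite I \<Longrightarrow> cfun.subspace (p I)"
    and act_linear: "\<lbrakk>finite I; inj_on \<sigma> I\<rbrakk> \<Longrightarrow> lin_map (p I) (p (\<sigma> ` I)) (act I \<sigma>)"
    and act_cong: "\<lbrakk>finite I; inj_on \<sigma> I; \<And>i. i \<in> I \<Longrightarrow> \<sigma> i = \<tau> i; x \<in> p I\<rbrakk>
      \<Longrightarrow> act I \<sigma> x = act I \<tau> x"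
    and act_id: "\<lbrakk>finite I; x \<in> p I\<rbrakk> \<Longrightarrow> act I id x = x"
    and act_comp: "\<lbrakk>finite I; inj_on \<sigma> I; inj_on \<tau> (\<sigma> ` I); x \<in> p I\<rbrakk>
      \<Longrightarrow> act I (\<tau> \<circ> \<sigma>) x = act (\<sigma> ` I) \<tau> (act I \<sigma> x)"

text \<open>
  The identification of \<open>p {}\<close> with the complex numbers is recorded by the vector \<open>u\<close> that
  corresponds to \<open>1\<close>.
\<close>

locale connected_species = vector_species p act
  for p :: "'a set \<Rightarrow> ('b \<Rightarrow> complex) set" and act +
  fixes u :: "'b \<Rightarrow> complex"
  assumes unit_nonzero: "u \<noteq> 0"
    and unit_span: "p {} = cfun.span {u}"

definition union_map :: "'a set \<Rightarrow> ('a \<Rightarrow> 'a) \<Rightarrow> ('a \<Rightarrow> 'a) \<Rightarrow> 'a \<Rightarrow> 'a" where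
  "union_map S \<sigma> \<tau> = (\<lambda>i. if i \<in> S then \<sigma> i else \<tau> i)"

locale hopf_monoid = connected_species p act u
  for p :: "'a set \<Rightarrow> ('b \<Rightarrow> complex) set" and act u +
  fixes \<mu> :: "'a set \<Rightarrow> 'a set \<Rightarrow> ('b \<times> 'b \<Rightarrow> complex) \<Rightarrow> ('b \<Rightarrow> complex)"
    and \<Delta> :: "'a set \<Rightarrow> 'a set \<Rightarrow> ('b \<Rightarrow> complex) \<Rightarrow> ('b \<times> 'b \<Rightarrow> complex)"
  assumes mult_linear:
      "\<lbrakk>finite S; finite T; S \<inter> T = {}\<rbrakk> \<Longrightarrow> lin_map (p S \<otimes>\<^sub>s p T) (p (S \<union> T)) (\<mu> S T)"
    and comult_linear:
      "\<lbrakk>finite S; finite T; S \<inter> T = {}\<rbrakk> \<Longrightarrow> lin_map (p (S \<union> T)) (p S \<otimes>\<^sub>s p T) (\<Delta> S T)"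
    and mult_natural:
      "\<lbrakk>finite S; finite T; S \<inter> T = {}; S' \<inter> T' = {}; bij_betw \<sigma> S S'; bij_betw \<tau> T T';
        t \<in> p S \<otimes>\<^sub>s p T\<rbrakk>
       \<Longrightarrow> act (S \<union> T) (union_map S \<sigma> \<tau>) (\<mu> S T t) = \<mu> S' T' ((act S \<sigma> \<otimes>\<^sub>m act T \<tau>) t)"
    and comult_natural:
      "\<lbrakk>finite S; finite T; S \<inter> T = {}; S' \<inter> T' = {}; bij_betw \<sigma> S S'; bij_betw \<tau> T T';
        x \<in> p (S \<union> T)\<rbrakk>
       \<Longrightarrow> (act S \<sigma> \<otimes>\<^sub>m act T \<tau>) (\<Delta> S T x) = \<Delta> S' T' (act (S \<union> T) (union_map S \<sigma> \<tau>) x)"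
    and mult_assoc:
      "\<lbrakk>finite R; finite S; finite T; R \<inter> S = {}; R \<inter> T = {}; S \<inter> T = {};
        w \<in> (p R \<otimes>\<^sub>s p S) \<otimes>\<^sub>s p T\<rbrakk>
       \<Longrightarrow> \<mu> (R \<union> S) T ((\<mu> R S \<otimes>\<^sub>m id) w) = \<mu> R (S \<union> T) ((id \<otimes>\<^sub>m \<mu> S T) (tensor_assoc w))"
    and comult_coassoc:
      "\<lbrakk>finite R; finite S; finite T; R \<inter> S = {}; R \<inter> T = {}; S \<inter> T = {};
        x \<in> p (R \<union> S \<union> T)\<rbrakk>
       \<Longrightarrow> tensor_assoc ((\<Delta> R S \<otimes>\<^sub>m id) (\<Delta> (R \<union> S) T x)) = (id \<otimes>\<^sub>m \<Delta> S T) (\<Delta> R (S \<union> T) x)"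
    and compatible:
      "\<lbrakk>finite I; S\<^sub>1 \<union> S\<^sub>2 = I; S\<^sub>1 \<inter> S\<^sub>2 = {}; T\<^sub>1 \<union> T\<^sub>2 = I; T\<^sub>1 \<inter> T\<^sub>2 = {};
        A = S\<^sub>1 \<inter> T\<^sub>1; B = S\<^sub>1 \<inter> T\<^sub>2; C = S\<^sub>2 \<inter> T\<^sub>1; D = S\<^sub>2 \<inter> T\<^sub>2; t \<in> p S\<^sub>1 \<otimes>\<^sub>s p S\<^sub>2\<rbrakk>
       \<Longrightarrow> \<Delta> T\<^sub>1 T\<^sub>2 (\<mu> S\<^sub>1 S\<^sub>2 t)
         = (\<mu> A C \<otimes>\<^sub>m \<mu> B D) (tensor_swap ((\<Delta> A B \<otimes>\<^sub>m \<Delta> C D) t))"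
    and mult_unit_right: "\<lbrakk>finite S; x \<in> p S\<rbrakk> \<Longrightarrow> \<mu> S {} (x \<otimes>\<^sub>v u) = x"
    and mult_unit_left: "\<lbrakk>finite S; x \<in> p S\<rbrakk> \<Longrightarrow> \<mu> {} S (u \<otimes>\<^sub>v x) = x"
    and comult_counit_right: "\<lbrakk>finite S; x \<in> p S\<rbrakk> \<Longrightarrow> \<Delta> S {} x = x \<otimes>\<^sub>v u"
    and comult_counit_left: "\<lbrakk>finite S; x \<in> p S\<rbrakk> \<Longrightarrow> \<Delta> {} S x = u \<otimes>\<^sub>v x"

text \<open>
  That the relabelling maps, the product and the coproduct of \<open>p\<close> restrict to \<open>q\<close> is part of
  \<open>hopf_monoid q act u \<mu> \<Delta>\<close>, by \<open>act_linear\<close>, \<open>mult_linear\<close> and \<open>comult_linear\<close>.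
\<close>

definition hopf_submonoid ::
  "('a set \<Rightarrow> ('b \<Rightarrow> complex) set) \<Rightarrow> ('a set \<Rightarrow> ('b \<Rightarrow> complex) set) \<Rightarrow>
   ('a set \<Rightarrow> ('a \<Rightarrow> 'a) \<Rightarrow> ('b \<Rightarrow> complex) \<Rightarrow> ('b \<Rightarrow> complex)) \<Rightarrow> ('b \<Rightarrow> complex) \<Rightarrow>
   ('a set \<Rightarrow> 'a set \<Rightarrow> ('b \<times> 'b \<Rightarrow> complex) \<Rightarrow> ('b \<Rightarrow> complex)) \<Rightarrow>
   ('a set \<Rightarrow> 'a set \<Rightarrow> ('b \<Rightarrow> complex) \<Rightarrow> ('b \<times> 'b \<Rightarrow> complex)) \<Rightarrow> bool" where
  "hopf_submonoid q p act u \<mu> \<Delta> \<longleftrightarrow>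
     hopf_monoid p act u \<mu> \<Delta> \<and>
     (\<forall>I. finite I \<longrightarrow> q I \<subseteq> p I) \<and>
     hopf_monoid q act u \<mu> \<Delta>"


section \<open>Pattern groups\<close>

text \<open>
  A poset on \<open>I\<close> is given by its reflexive order relation. A matrix indexed by \<open>I\<close> is a function
  that vanishes outside \<open>I \<times> I\<close>; in particular the identity matrix depends on \<open>I\<close>. Addition and
  subtraction of matrices are the pointwise operations on functions.
\<close>

type_synonym ('a, 'k) mtx = "'a \<Rightarrow> 'a \<Rightarrow> 'k"

definition posets :: "'a set \<Rightarrow> 'a rel set" where
  "posets I = {P. partial_order_on I P}"

definition prec :: "'a rel \<Rightarrow> 'a \<Rightarrow> 'a \<Rightarrow> bool" where
  "prec P i j \<longleftrightarrow> (i, j) \<in> P \<and> i \<noteq> j"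

definition mtx_mult :: "'a set \<Rightarrow> ('a, 'k::semiring_0) mtx \<Rightarrow> ('a, 'k) mtx \<Rightarrow> ('a, 'k) mtx" where
  "mtx_mult I g h = (\<lambda>i j. \<Sum>k\<in>I. g i k * h k j)"

definition mtx_one :: "'a set \<Rightarrow> ('a, 'k::zero_neq_one) mtx" where
  "mtx_one I = (\<lambda>i j. if i \<in> I \<and> i = j then 1 else 0)"

definition pattern_algebra :: "'a rel \<Rightarrow> ('a, 'k::field) mtx set" where
  "pattern_algebra P = {x. \<forall>i j. \<not> prec P i j \<longrightarrow> x i j = 0}"

definition pattern_group :: "'a set \<Rightarrow> 'a rel \<Rightarrow> ('a, 'k::field) mtx set" where
  "pattern_group I P = {mtx_one I + x | x. x \<in> pattern_algebra P}"

definition funs_on :: "'x set \<Rightarrow> ('x \<Rightarrow> complex) set" where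
  "funs_on X = {\<alpha>. \<forall>x. x \<notin> X \<longrightarrow> \<alpha> x = 0}"

definition superclass ::
  "'a set \<Rightarrow> 'a rel \<Rightarrow> ('a, 'k::field) mtx \<Rightarrow> ('a, 'k) mtx set" where
  "superclass I P g = {h \<in> pattern_group I P.
     \<exists>a\<in>pattern_group I P. \<exists>b\<in>pattern_group I P.
       h - mtx_one I = mtx_mult I (mtx_mult I a (g - mtx_one I)) b}"

definition scf :: "'a set \<Rightarrow> 'a rel \<Rightarrow> (('a, 'k::field) mtx \<Rightarrow> complex) set" where
  "scf I P = {\<alpha> \<in> funs_on (pattern_group I P).
     \<forall>g\<in>pattern_group I P. \<forall>h\<in>superclass I P g. \<forall>h'\<in>superclass I P g. \<alpha> h = \<alpha> h'}"

text \<open>The labelled arc from \<open>i\<close> to \<open>j\<close> with label \<open>c\<close> is the triple \<open>(i, c, j)\<close>.\<close>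

definition sml :: "'a rel \<Rightarrow> ('a, 'k::field) mtx \<Rightarrow> ('a \<times> 'k \<times> 'a) set" where
  "sml P g = {(i, g i j, j) | i j. prec P i j \<and> g i j \<noteq> 0 \<and>
     (\<forall>k l. (k, l) \<noteq> (i, j) \<and> (i, k) \<in> P \<and> prec P k l \<and> (l, j) \<in> P \<longrightarrow> g k l = 0)}"

definition nnf :: "'a set \<Rightarrow> 'a rel \<Rightarrow> (('a, 'k::field) mtx \<Rightarrow> complex) set" where
  "nnf I P = {\<alpha> \<in> funs_on (pattern_group I P).
     \<forall>g\<in>pattern_group I P. \<forall>h\<in>pattern_group I P. sml P g = sml P h \<longrightarrow> \<alpha> g = \<alpha> h}"


section \<open>The Hopf monoids of functions on pattern groups\<close>

text \<open>
  An element of the direct sum over all posets on \<open>I\<close> is a function \<open>v\<close> of pairs \<open>(P, g)\<close> whose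
  component at \<open>P\<close> is \<open>\<lambda>g. v (P, g)\<close>. Since \<open>I\<close> has only finitely many partial orders when it is
  finite, no support condition is needed. The finiteness of the field is the sort constraint on
  \<open>'k\<close>.
\<close>

type_synonym ('a, 'k) pvec = "'a rel \<times> ('a, 'k) mtx \<Rightarrow> complex"

definition poset_sum ::
  "'a set \<Rightarrow> ('a rel \<Rightarrow> (('a, 'k) mtx \<Rightarrow> complex) set) \<Rightarrow> ('a, 'k) pvec set" where
  "poset_sum I F = {v. (\<forall>P\<in>posets I. (\<lambda>g. v (P, g)) \<in> F P) \<and> (\<forall>P g. P \<notin> posets I \<longrightarrow> v (P, g) = 0)}"

definition fp :: "'a set \<Rightarrow> ('a, 'k::{field,finite}) pvec set" where
  "fp I = poset_sum I (\<lambda>P. funs_on (pattern_group I P))"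

definition scfp :: "'a set \<Rightarrow> ('a, 'k::{field,finite}) pvec set" where
  "scfp I = poset_sum I (scf I)"

definition nnfp :: "'a set \<Rightarrow> ('a, 'k::{field,finite}) pvec set" where
  "nnfp I = poset_sum I (nnf I)"

definition restrict0 :: "'x set \<Rightarrow> ('x \<Rightarrow> complex) \<Rightarrow> 'x \<Rightarrow> complex" where
  "restrict0 X \<alpha> = (\<lambda>x. if x \<in> X then \<alpha> x else 0)"

definition incl :: "'a rel \<Rightarrow> (('a, 'k) mtx \<Rightarrow> complex) \<Rightarrow> ('a, 'k) pvec" where
  "incl P \<alpha> = (\<lambda>(P', g). if P' = P then \<alpha> g else 0)"

definition incl2 ::
  "'a rel \<Rightarrow> 'a rel \<Rightarrow> (('a, 'k) mtx \<times> ('a, 'k) mtx \<Rightarrow> complex) \<Rightarrow>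
   ('a rel \<times> ('a, 'k) mtx) \<times> ('a rel \<times> ('a, 'k) mtx) \<Rightarrow> complex" where
  "incl2 P Q \<alpha> = (\<lambda>((P', g), (Q', h)). if P' = P \<and> Q' = Q then \<alpha> (g, h) else 0)"

text \<open>
  The action of a bijection \<open>\<sigma>\<close> sends \<open>\<alpha>\<close> in the summand of \<open>P\<close> to its composite with the
  isomorphism \<open>h \<mapsto> relabel_mtx I \<sigma> h\<close> from the pattern group of \<open>\<sigma>P\<close> to that of \<open>P\<close>. Here and
  below, linear extension amounts to summing over the components of a vector.
\<close>

definition relabel_mtx :: "'a set \<Rightarrow> ('a \<Rightarrow> 'a) \<Rightarrow> ('a, 'k::zero) mtx \<Rightarrow> ('a, 'k) mtx" where
  "relabel_mtx I \<sigma> h = (\<lambda>i j. if i \<in> I \<and> j \<in> I then h (\<sigma> i) (\<sigma> j) else 0)"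

definition fp_act ::
  "'a set \<Rightarrow> ('a \<Rightarrow> 'a) \<Rightarrow> ('a, 'k::{field,finite}) pvec \<Rightarrow> ('a, 'k) pvec" where
  "fp_act I \<sigma> v = (\<Sum>P\<in>posets I. let \<sigma>P = map_prod \<sigma> \<sigma> ` P in
     incl \<sigma>P (restrict0 (pattern_group (\<sigma> ` I) \<sigma>P) (\<lambda>h. v (P, relabel_mtx I \<sigma> h))))"

text \<open>The empty set carries exactly one poset, and its pattern group is trivial.\<close>

definition fp_unit :: "('a, 'k::{field,finite}) pvec" where
  "fp_unit = incl {} (restrict0 (pattern_group {} {}) (\<lambda>_. 1))"

definition ordinal_sum :: "'a set \<Rightarrow> 'a set \<Rightarrow> 'a rel \<Rightarrow> 'a rel \<Rightarrow> 'a rel" where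
  "ordinal_sum S T P Q = P \<union> Q \<union> S \<times> T"

definition block :: "'a set \<Rightarrow> ('a, 'k::zero) mtx \<Rightarrow> ('a, 'k) mtx" where
  "block S g = (\<lambda>i j. if i \<in> S \<and> j \<in> S then g i j else 0)"

definition block_sum ::
  "'a set \<Rightarrow> 'a set \<Rightarrow> ('a, 'k::zero) mtx \<Rightarrow> ('a, 'k) mtx \<Rightarrow> ('a, 'k) mtx" where
  "block_sum S T g h =
     (\<lambda>i j. if i \<in> S \<and> j \<in> S then g i j else if i \<in> T \<and> j \<in> T then h i j else 0)"

definition fp_mult ::
  "'a set \<Rightarrow> 'a set \<Rightarrow>
   (('a rel \<times> ('a, 'k::{field,finite}) mtx) \<times> ('a rel \<times> ('a, 'k) mtx) \<Rightarrow> complex) \<Rightarrow>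
   ('a, 'k) pvec" where
  "fp_mult S T t = (\<Sum>(P, Q) \<in> posets S \<times> posets T. let PQ = ordinal_sum S T P Q in
     incl PQ (restrict0 (pattern_group (S \<union> T) PQ) (\<lambda>g. t ((P, block S g), (Q, block T g)))))"

definition fp_comult ::
  "'a set \<Rightarrow> 'a set \<Rightarrow> ('a, 'k::{field,finite}) pvec \<Rightarrow>
   (('a rel \<times> ('a, 'k) mtx) \<times> ('a rel \<times> ('a, 'k) mtx) \<Rightarrow> complex)" where
  "fp_comult S T v = (\<Sum>P\<in>posets (S \<union> T).
     incl2 (Restr P S) (Restr P T)
       (restrict0 (pattern_group S (Restr P S) \<times> pattern_group T (Restr P T))
         (\<lambda>(g, h). v (P, block_sum S T g h))))"

end

theory Submission
  imports Defs
begin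

text \<open>
  Both species consist of the vectors that are invariant under a relation on the pattern groups, for
  which it is enough to know that it is preserved by relabelling, by passing to the block of an
  order-convex subset (this gives closure under the product) and by adding a common block (this
  gives closure under the coproduct). The Hopf monoid axioms themselves hold for arbitrary vectors
  and express bijections between the posets that glue given posets. That invariant functions of
  pairs lie in the tensor product follows from averaging over classes, by finiteness.
  For the inclusion, multiplying \<open>g - 1\<close> by unipotent matrices on both sides changes an entry only by
  multiples of entries inside the corresponding interval, so the minimal nonzero entries are fixed.
\<close>

section \<open>Posets and their pattern groups\<close>

text \<open>A poset on S \<union> T that contains S \<times> T determines its two parts, so each
  component of a product receives at most one term. Restriction, in contrast, forgets the relations
  between S and T, so many posets contribute to one component of a coproduct; this is the source of
  all the reindexing. Convexity enters because both multiplication and the test for minimal entries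
  look at whole intervals, and an interval with ends in S may leave S. In an ordinal sum the lower
  part is a down-set and the upper part an up-set, so no interval escapes. The coproduct meets
  arbitrary S, but there the map runs from the blocks into the whole matrix. For minimal arcs this
  is the delicate direction: an arc between elements of T may enclose entries of the block on S. For
  the inclusion, entries of two matrices in one superclass may differ away from the minimal
  positions. Zeros therefore pass directly only from \<open>g\<close> to \<open>h\<close>; the way
  back goes through a smallest nonzero entry.\<close>

lemma posets_iff:
  "P \<in> posets I \<longleftrightarrow> P \<subseteq> I \<times> I \<and> (\<forall>i\<in>I. (i, i) \<in> P) \<and>
     (\<forall>i j. (i, j) \<in> P \<longrightarrow> (j, i) \<in> P \<longrightarrow> i = j) \<and>
     (\<forall>i j k. (i, j) \<in> P \<longrightarrow> (j, k) \<in> P \<longrightarrow> (i, k) \<in> P)"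
  unfolding posets_def partial_order_on_def preorder_on_def refl_on_def antisym_def trans_def
  by blast

lemma posets_subset: "P \<in> posets I \<Longrightarrow> P \<subseteq> I \<times> I"
  by (simp add: posets_iff)

lemma posets_dom:
  assumes "P \<in> posets I" "(i, j) \<in> P"
  shows "i \<in> I" "j \<in> I"
  using assms by (auto simp: posets_iff)

lemma posets_refl: "P \<in> posets I \<Longrightarrow> i \<in> I \<Longrightarrow> (i, i) \<in> P"
  by (simp add: posets_iff)

lemma posets_antisym: "P \<in> posets I \<Longrightarrow> (i, j) \<in> P \<Longrightarrow> (j, i) \<in> P \<Longrightarrow> i = j"
  unfolding posets_iff by blast

lemma posets_trans: "P \<in> posets I \<Longrightarrow> (i, j) \<in> P \<Longrightarrow> (j, k) \<in> P \<Longrightarrow> (i, k) \<in> P"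
  unfolding posets_iff by blast

lemma finite_posets: "finite I \<Longrightarrow> finite (posets I)"
  by (rule finite_subset[of _ "Pow (I \<times> I)"]) (auto dest: posets_subset)

lemma posets_empty: "posets {} = {{}}"
  by (auto simp: posets_iff)

lemma Restr_posets: "P \<in> posets I \<Longrightarrow> S \<subseteq> I \<Longrightarrow> Restr P S \<in> posets S"
  unfolding posets_iff by blast

lemma Restr_eq_self: "P \<in> posets I \<Longrightarrow> Restr P I = P"
  unfolding posets_iff by blast

lemma Restr_Restr: "S \<subseteq> T \<Longrightarrow> Restr (Restr R T) S = Restr R S"
  by auto

lemma ordinal_sum_posets:
  assumes P: "P \<in> posets S" and Q: "Q \<in> posets T" and "S \<inter> T = {}"
  shows "ordinal_sum S T P Q \<in> posets (S \<union> T)"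
  unfolding posets_iff
proof (intro conjI ballI allI impI)
  note dom = posets_dom[OF P] posets_dom[OF Q]
  show "ordinal_sum S T P Q \<subseteq> (S \<union> T) \<times> (S \<union> T)"
    using posets_subset[OF P] posets_subset[OF Q] unfolding ordinal_sum_def by auto
  show "(i, i) \<in> ordinal_sum S T P Q" if "i \<in> S \<union> T" for i
    using that posets_refl[OF P] posets_refl[OF Q] unfolding ordinal_sum_def by auto
  show "i = j" if "(i, j) \<in> ordinal_sum S T P Q" "(j, i) \<in> ordinal_sum S T P Q" for i j
    using that assms(3) dom posets_antisym[OF P] posets_antisym[OF Q]
    unfolding ordinal_sum_def by (metis IntI SigmaD1 SigmaD2 UnE empty_iff)
  show "(i, k) \<in> ordinal_sum S T P Q"
    if "(i, j) \<in> ordinal_sum S T P Q" "(j, k) \<in> ordinal_sum S T P Q" for i j k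
    using that assms(3) dom posets_trans[OF P] posets_trans[OF Q]
    unfolding ordinal_sum_def by (metis IntI SigmaD1 SigmaD2 SigmaI UnCI UnE empty_iff)
qed

lemma Restr_ordinal_sum:
  assumes "P \<in> posets S" "Q \<in> posets T" "S \<inter> T = {}"
  shows "Restr (ordinal_sum S T P Q) S = P" "Restr (ordinal_sum S T P Q) T = Q"
  using posets_subset[OF assms(1)] posets_subset[OF assms(2)] assms(3)
  unfolding ordinal_sum_def by auto

text \<open>Antisymmetry forbids any relation from T to S once all of S lies below T, so nothing is
  lost by restricting. Containing S \<times> T thus characterises the ordinal sums among the posets
  on S \<union> T.\<close>

lemma ordinal_sum_Restr:
  assumes "R \<in> posets (S \<union> T)" "S \<inter> T = {}" "S \<times> T \<subseteq> R"
  shows "ordinal_sum S T (Restr R S) (Restr R T) = R"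
proof -
  have "(i, j) \<notin> R" if "i \<in> T" "j \<in> S" for i j
  proof
    assume "(i, j) \<in> R"
    moreover have "(j, i) \<in> R" using that assms(3) by auto
    ultimately have "i = j" using posets_antisym[OF assms(1)] by blast
    thus False using that assms(2) by blast
  qed
  thus ?thesis
    using assms(3) posets_subset[OF assms(1)] unfolding ordinal_sum_def by blast
qed

text \<open>The inverse of relabelling on posets. The pointwise form of the action starts from a
  poset on the image of I and asks which summand it comes from.\<close>

definition pullback :: "'a set \<Rightarrow> ('a \<Rightarrow> 'a) \<Rightarrow> 'a rel \<Rightarrow> 'a rel" where
  "pullback I \<sigma> P = {(i, j). i \<in> I \<and> j \<in> I \<and> (\<sigma> i, \<sigma> j) \<in> P}"

lemma pullback_posets:
  assumes "P \<in> posets (\<sigma> ` I)" "inj_on \<sigma> I"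
  shows "pullback I \<sigma> P \<in> posets I"
  using assms unfolding pullback_def posets_iff inj_on_def by blast

lemma map_prod_posets:
  assumes "P \<in> posets I" "inj_on \<sigma> I"
  shows "map_prod \<sigma> \<sigma> ` P \<in> posets (\<sigma> ` I)"
proof -
  have eq: "x = y" if "\<sigma> x = \<sigma> y" "x \<in> I" "y \<in> I" for x y
    using assms(2) that by (auto simp: inj_on_def)
  show ?thesis
    unfolding posets_iff
  proof (intro conjI ballI allI impI)
    show "map_prod \<sigma> \<sigma> ` P \<subseteq> \<sigma> ` I \<times> \<sigma> ` I"
      using posets_subset[OF assms(1)] by auto
    show "(i, i) \<in> map_prod \<sigma> \<sigma> ` P" if "i \<in> \<sigma> ` I" for i
      using that posets_refl[OF assms(1)] by force
  next
    fix i j assume "(i, j) \<in> map_prod \<sigma> \<sigma> ` P" "(j, i) \<in> map_prod \<sigma> \<sigma> ` P"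
    then obtain x y y' x' where *: "(x, y) \<in> P" "(y', x') \<in> P" "i = \<sigma> x" "j = \<sigma> y" "j = \<sigma> y'" "i = \<sigma> x'"
      by auto
    hence "y' = y" "x' = x" using posets_dom[OF assms(1)] eq by metis+
    thus "i = j" using * posets_antisym[OF assms(1)] by blast
  next
    fix i j k assume "(i, j) \<in> map_prod \<sigma> \<sigma> ` P" "(j, k) \<in> map_prod \<sigma> \<sigma> ` P"
    then obtain x y y' z where *: "(x, y) \<in> P" "(y', z) \<in> P" "i = \<sigma> x" "j = \<sigma> y" "j = \<sigma> y'" "k = \<sigma> z"
      by auto
    hence "y' = y" using posets_dom[OF assms(1)] eq by metis
    hence "(x, z) \<in> P" using * posets_trans[OF assms(1)] by blast
    thus "(i, k) \<in> map_prod \<sigma> \<sigma> ` P" using * by force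
  qed
qed

lemma pullback_map_prod:
  assumes "P \<in> posets I" "inj_on \<sigma> I"
  shows "pullback I \<sigma> (map_prod \<sigma> \<sigma> ` P) = P"
proof -
  have inj: "\<sigma> i = \<sigma> j \<longleftrightarrow> i = j" if "i \<in> I" "j \<in> I" for i j
    using assms(2) that by (auto simp: inj_on_def)
  show ?thesis
    using posets_subset[OF assms(1)] inj unfolding pullback_def
    by (auto; metis SigmaD1 SigmaD2 subsetD)
qed

lemma map_prod_pullback:
  assumes "P \<in> posets (\<sigma> ` I)"
  shows "map_prod \<sigma> \<sigma> ` pullback I \<sigma> P = P"
  using posets_subset[OF assms] unfolding pullback_def by force

section \<open>Entrywise description of pattern groups, blocks and block sums\<close>

lemma pattern_group_iff:
  "g \<in> pattern_group I P \<longleftrightarrow> (\<forall>i j. \<not> prec P i j \<longrightarrow> g i j = mtx_one I i j)"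
  (is "?L = ?R")
proof
  assume ?R
  hence "g - mtx_one I \<in> pattern_algebra P" by (auto simp: pattern_algebra_def)
  moreover have "g = mtx_one I + (g - mtx_one I)" by (simp add: fun_eq_iff)
  ultimately show ?L unfolding pattern_group_def by blast
qed (auto simp: pattern_group_def pattern_algebra_def)

lemma pattern_group_diag: "g \<in> pattern_group I P \<Longrightarrow> i \<in> I \<Longrightarrow> g i i = 1"
  by (simp add: pattern_group_iff prec_def mtx_one_def)

lemma pattern_group_zero:
  "g \<in> pattern_group I P \<Longrightarrow> P \<in> posets I \<Longrightarrow> (i, j) \<notin> P \<Longrightarrow> g i j = 0"
  by (auto simp: pattern_group_iff prec_def mtx_one_def posets_refl)

lemma mtx_one_pattern_group [simp]: "mtx_one I \<in> pattern_group I P"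
  by (simp add: pattern_group_iff)

lemma pattern_group_diff_zero:
  "g \<in> pattern_group I P \<Longrightarrow> \<not> prec P i j \<Longrightarrow> g i j - mtx_one I i j = 0"
  by (simp add: pattern_group_iff)

lemma finite_pattern_group:
  assumes "finite I" "P \<in> posets I"
  shows "finite (pattern_group I P :: ('a, 'k::{field,finite}) mtx set)"
proof -
  \<comment> \<open>The possible rows of a matrix supported on I. The set is shaped after
    \<open>finite_set_of_finite_funs\<close>, which is used once for rows and once for matrices as
    families of rows.\<close>
  define B :: "('a \<Rightarrow> 'k) set" where
    "B = {f. \<forall>x. (x \<in> I \<longrightarrow> f x \<in> UNIV) \<and> (x \<notin> I \<longrightarrow> f x = 0)}"
  have "finite B"
    unfolding B_def by (rule finite_set_of_finite_funs[OF assms(1)]) simp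
  hence fin: "finite {g. \<forall>i. (i \<in> I \<longrightarrow> g i \<in> B) \<and> (i \<notin> I \<longrightarrow> g i = (\<lambda>_. 0))}"
    by (rule finite_set_of_finite_funs[OF assms(1)])
  have "g i j = 0" if "g \<in> pattern_group I P" "i \<notin> I \<or> j \<notin> I" for g :: "('a, 'k) mtx" and i j
    using pattern_group_zero[OF that(1) assms(2)] posets_dom[OF assms(2)] that(2) by blast
  thus ?thesis
    by (intro finite_subset[OF _ fin]) (auto simp: B_def)
qed

lemma pattern_group_empty: "pattern_group {} {} = {\<lambda>_ _. 0}"
  by (auto simp: pattern_group_iff prec_def mtx_one_def fun_eq_iff)

lemma block_pattern_group:
  "g \<in> pattern_group I P \<Longrightarrow> S \<subseteq> I \<Longrightarrow> block S g \<in> pattern_group S (Restr P S)"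
  by (auto simp: pattern_group_iff block_def prec_def mtx_one_def)

lemma block_block: "S \<subseteq> T \<Longrightarrow> block S (block T g) = block S g"
  by (auto simp: block_def fun_eq_iff)

lemma block_self:
  assumes "g \<in> pattern_group I P" "P \<in> posets I"
  shows "block I g = g"
proof (intro ext)
  fix i j show "block I g i j = g i j"
    using pattern_group_zero[OF assms, of i j] posets_dom[OF assms(2), of i j]
    unfolding block_def by metis
qed

lemma block_sum_commute: "S \<inter> T = {} \<Longrightarrow> block_sum S T g h = block_sum T S h g"
  by (auto simp: block_sum_def fun_eq_iff)

text \<open>The entries between S and T are zero, which is admissible whether or not R relates the
  two indices. One block sum therefore lies in the group of every poset with the given
  restrictions.\<close>

lemma block_sum_pattern_group:
  assumes "g \<in> pattern_group S (Restr R S)" "h \<in> pattern_group T (Restr R T)" "S \<inter> T = {}"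
  shows "block_sum S T g h \<in> pattern_group (S \<union> T) R"
  using assms by (auto simp: pattern_group_iff block_sum_def prec_def mtx_one_def)

lemma relabel_pattern_group:
  assumes "g \<in> pattern_group (\<sigma> ` I) P" "inj_on \<sigma> I"
  shows "relabel_mtx I \<sigma> g \<in> pattern_group I (pullback I \<sigma> P)"
  using assms
  by (auto simp: pattern_group_iff relabel_mtx_def prec_def mtx_one_def pullback_def inj_on_def)


section \<open>Pointwise form of the structure maps\<close>

text \<open>The index set of the sum that the coproduct leaves at the component (P, Q).\<close>

definition glueings :: "'a set \<Rightarrow> 'a set \<Rightarrow> 'a rel \<Rightarrow> 'a rel \<Rightarrow> 'a rel set" where
  "glueings S T P Q = {R \<in> posets (S \<union> T). Restr R S = P \<and> Restr R T = Q}"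

lemma finite_glueings: "finite S \<Longrightarrow> finite T \<Longrightarrow> finite (glueings S T P Q)"
  by (simp add: glueings_def finite_posets)

lemma glueings_posets:
  assumes "R \<in> glueings S T P Q"
  shows "R \<in> posets (S \<union> T)" "P \<in> posets S" "Q \<in> posets T" "Restr R S = P" "Restr R T = Q"
  using assms Restr_posets[of R "S \<union> T" S] Restr_posets[of R "S \<union> T" T] by (auto simp: glueings_def)

lemma sum_apply: "(sum f A) x = (\<Sum>a\<in>A. f a x)"
  by (induction A rule: infinite_finite_induct) auto

text \<open>Relabelling is a bijection between posets, so the summand of
  \<open>pullback I \<sigma> P\<close> is the only one that reaches the component P.\<close>

lemma fp_act_apply:
  assumes "finite I" "inj_on \<sigma> I"
  shows "fp_act I \<sigma> v (P, g) =
    (if P \<in> posets (\<sigma> ` I) \<and> g \<in> pattern_group (\<sigma> ` I) P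
     then v (pullback I \<sigma> P, relabel_mtx I \<sigma> g) else 0)"
proof -
  have "fp_act I \<sigma> v (P, g) = (\<Sum>Q\<in>posets I. if Q = pullback I \<sigma> P then
      if P \<in> posets (\<sigma> ` I) \<and> g \<in> pattern_group (\<sigma> ` I) P
      then v (pullback I \<sigma> P, relabel_mtx I \<sigma> g) else 0 else 0)"
    unfolding fp_act_def sum_apply
  proof (rule sum.cong[OF refl])
    fix Q assume Q: "Q \<in> posets I"
    have "P = map_prod \<sigma> \<sigma> ` Q \<longleftrightarrow> P \<in> posets (\<sigma> ` I) \<and> Q = pullback I \<sigma> P"
      using map_prod_posets[OF Q assms(2)] pullback_map_prod[OF Q assms(2)] map_prod_pullback
      by metis
    thus "(let \<sigma>P = map_prod \<sigma> \<sigma> ` Q in incl \<sigma>P (restrict0 (pattern_group (\<sigma> ` I) \<sigma>P)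
            (\<lambda>h. v (Q, relabel_mtx I \<sigma> h)))) (P, g) =
         (if Q = pullback I \<sigma> P then
      if P \<in> posets (\<sigma> ` I) \<and> g \<in> pattern_group (\<sigma> ` I) P
      then v (pullback I \<sigma> P, relabel_mtx I \<sigma> g) else 0 else 0)"
      by (auto simp: Let_def incl_def restrict0_def)
  qed
  also have "\<dots> = (if P \<in> posets (\<sigma> ` I) \<and> g \<in> pattern_group (\<sigma> ` I) P
     then v (pullback I \<sigma> P, relabel_mtx I \<sigma> g) else 0)"
    using pullback_posets[OF _ assms(2), of P] by (simp add: finite_posets[OF assms(1)])
  finally show ?thesis .
qed

text \<open>The parts of an ordinal sum are recovered by restriction, so only the pair
  \<open>(Restr R S, Restr R T)\<close> can contribute to R, and it does so exactly when R is that
  ordinal sum.\<close>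

lemma fp_mult_apply:
  assumes "finite S" "finite T" "S \<inter> T = {}"
  shows "fp_mult S T t (R, g) =
    (if R \<in> posets (S \<union> T) \<and> S \<times> T \<subseteq> R \<and> g \<in> pattern_group (S \<union> T) R
     then t ((Restr R S, block S g), (Restr R T, block T g)) else 0)"
proof -
  let ?c = "if R \<in> posets (S \<union> T) \<and> S \<times> T \<subseteq> R \<and> g \<in> pattern_group (S \<union> T) R
     then t ((Restr R S, block S g), (Restr R T, block T g)) else 0"
  have "fp_mult S T t (R, g) =
      (\<Sum>x\<in>posets S \<times> posets T. if x = (Restr R S, Restr R T) then ?c else 0)"
    unfolding fp_mult_def sum_apply
  proof (rule sum.cong[OF refl])
    fix x assume "x \<in> posets S \<times> posets T"
    then obtain P Q where x: "x = (P, Q)" "P \<in> posets S" "Q \<in> posets T" by auto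
    have "S \<times> T \<subseteq> ordinal_sum S T P Q" by (auto simp: ordinal_sum_def)
    hence "R = ordinal_sum S T P Q \<longleftrightarrow>
        R \<in> posets (S \<union> T) \<and> S \<times> T \<subseteq> R \<and> P = Restr R S \<and> Q = Restr R T"
      using ordinal_sum_posets[OF x(2,3) assms(3)] Restr_ordinal_sum[OF x(2,3) assms(3)]
        ordinal_sum_Restr[of R S T] assms(3) by blast
    thus "(case x of (P, Q) \<Rightarrow> let PQ = ordinal_sum S T P Q in
        incl PQ (restrict0 (pattern_group (S \<union> T) PQ)
          (\<lambda>g. t ((P, block S g), (Q, block T g))))) (R, g) =
        (if x = (Restr R S, Restr R T) then ?c else 0)"
      by (auto simp: x(1) Let_def incl_def restrict0_def)
  qed
  also have "\<dots> = ?c"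
    using Restr_posets[of R "S \<union> T" S] Restr_posets[of R "S \<union> T" T] assms
    by (auto simp: sum.delta finite_posets)
  finally show ?thesis .
qed

text \<open>Different posets may share both restrictions, so a sum remains. The support test is the
  same for all terms and is pulled out; that P and Q are posets is implicit, as otherwise there is
  no glueing.\<close>

lemma fp_comult_apply:
  assumes "finite S" "finite T"
  shows "fp_comult S T v ((P, g), (Q, h)) =
    (if g \<in> pattern_group S P \<and> h \<in> pattern_group T Q
     then \<Sum>R\<in>glueings S T P Q. v (R, block_sum S T g h) else 0)"
proof -
  let ?c = "\<lambda>R. if g \<in> pattern_group S P \<and> h \<in> pattern_group T Q
     then v (R, block_sum S T g h) else 0"
  have "fp_comult S T v ((P, g), (Q, h)) =
      (\<Sum>R\<in>posets (S \<union> T). if Restr R S = P \<and> Restr R T = Q then ?c R else 0)"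
    unfolding fp_comult_def sum_apply
    by (rule sum.cong) (auto simp: incl2_def restrict0_def)
  also have "\<dots> = (\<Sum>R\<in>glueings S T P Q. ?c R)"
    unfolding glueings_def using assms
    by (simp add: sum.inter_filter finite_posets)
  also have "\<dots> = (if g \<in> pattern_group S P \<and> h \<in> pattern_group T Q
     then \<Sum>R\<in>glueings S T P Q. v (R, block_sum S T g h) else 0)"
    by (auto intro: sum.neutral)
  finally show ?thesis .
qed


section \<open>Axioms holding for all vectors\<close>

lemma fp_act_cong:
  assumes "finite I" "inj_on \<sigma> I" "\<And>i. i \<in> I \<Longrightarrow> \<sigma> i = \<tau> i"
  shows "fp_act I \<sigma> x = fp_act I \<tau> x"
proof -
  have "inj_on \<tau> I" using assms(2,3) by (simp add: inj_on_def)
  moreover have "\<sigma> ` I = \<tau> ` I" using assms(3) by auto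
  moreover have "pullback I \<sigma> P = pullback I \<tau> P" for P
    using assms(3) by (auto simp: pullback_def)
  moreover have "relabel_mtx I \<sigma> g = relabel_mtx I \<tau> g" for g :: "('a, 'b) mtx"
    using assms(3) by (auto simp: relabel_mtx_def fun_eq_iff)
  ultimately have "fp_act I \<sigma> x (P, g) = fp_act I \<tau> x (P, g)" for P g
    using assms(1,2) by (simp add: fp_act_apply)
  thus ?thesis by auto
qed

lemma fp_act_comp:
  assumes "finite I" "inj_on \<sigma> I" "inj_on \<tau> (\<sigma> ` I)"
  shows "fp_act I (\<tau> \<circ> \<sigma>) x = fp_act (\<sigma> ` I) \<tau> (fp_act I \<sigma> x)"
proof (intro ext, clarify)
  fix P and g :: "('a, 'b) mtx"
  have "pullback I \<sigma> (pullback (\<sigma> ` I) \<tau> P) = pullback I (\<tau> \<circ> \<sigma>) P"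
    by (auto simp: pullback_def)
  moreover have "relabel_mtx I \<sigma> (relabel_mtx (\<sigma> ` I) \<tau> g) = relabel_mtx I (\<tau> \<circ> \<sigma>) g"
    by (auto simp: relabel_mtx_def fun_eq_iff)
  ultimately show "fp_act I (\<tau> \<circ> \<sigma>) x (P, g) = fp_act (\<sigma> ` I) \<tau> (fp_act I \<sigma> x) (P, g)"
    using assms pullback_posets[of P \<tau> "\<sigma> ` I"] relabel_pattern_group[of g \<tau> "\<sigma> ` I" P]
    by (simp add: fp_act_apply comp_inj_on image_comp)
qed

section \<open>Naturality of the product and the coproduct\<close>

lemma union_map_facts:
  assumes "S \<inter> T = {}" "S' \<inter> T' = {}" "bij_betw \<sigma> S S'" "bij_betw \<tau> T T'"
  shows "inj_on (union_map S \<sigma> \<tau>) (S \<union> T)" "union_map S \<sigma> \<tau> ` (S \<union> T) = S' \<union> T'"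
    "\<And>i. i \<in> S \<Longrightarrow> union_map S \<sigma> \<tau> i = \<sigma> i" "\<And>i. i \<in> T \<Longrightarrow> union_map S \<sigma> \<tau> i = \<tau> i"
    "\<And>i. i \<in> S \<Longrightarrow> \<sigma> i \<in> S'" "\<And>i. i \<in> T \<Longrightarrow> \<tau> i \<in> T'"
proof -
  show 1: "union_map S \<sigma> \<tau> i = \<sigma> i" if "i \<in> S" for i using that by (simp add: union_map_def)
  show 2: "union_map S \<sigma> \<tau> i = \<tau> i" if "i \<in> T" for i
    using that assms(1) by (auto simp: union_map_def)
  have "bij_betw (union_map S \<sigma> \<tau>) S S'" "bij_betw (union_map S \<sigma> \<tau>) T T'"
    using assms(3,4) 1 2 by (metis bij_betw_cong)+
  hence "bij_betw (union_map S \<sigma> \<tau>) (S \<union> T) (S' \<union> T')"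
    using assms(2) by (rule bij_betw_combine)
  thus "inj_on (union_map S \<sigma> \<tau>) (S \<union> T)" "union_map S \<sigma> \<tau> ` (S \<union> T) = S' \<union> T'"
    by (auto simp: bij_betw_def)
  show "\<And>i. i \<in> S \<Longrightarrow> \<sigma> i \<in> S'" "\<And>i. i \<in> T \<Longrightarrow> \<tau> i \<in> T'"
    using assms(3,4) by (auto simp: bij_betw_def)
qed

context
  fixes S T S' T' :: "'a set" and \<sigma> \<tau> :: "'a \<Rightarrow> 'a"
  assumes fin: "finite S" "finite T"
    and disj: "S \<inter> T = {}" "S' \<inter> T' = {}"
    and bij: "bij_betw \<sigma> S S'" "bij_betw \<tau> T T'"
begin

private abbreviation "\<rho> \<equiv> union_map S \<sigma> \<tau>"

private lemmas rho = union_map_facts[OF disj bij]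

private lemma fin': "finite S'" "finite T'"
  using bij fin bij_betw_finite by auto

private lemma inj: "inj_on \<sigma> S" "inj_on \<tau> T" and img: "\<sigma> ` S = S'" "\<tau> ` T = T'"
  using bij by (auto simp: bij_betw_def)

private lemma Restr_pullback:
  "Restr (pullback (S \<union> T) \<rho> R) S = pullback S \<sigma> (Restr R S')"
  "Restr (pullback (S \<union> T) \<rho> R) T = pullback T \<tau> (Restr R T')"
  using disj(1) by (auto simp: pullback_def rho(3-6) disjoint_iff)

private lemma block_relabel:
  "block S (relabel_mtx (S \<union> T) \<rho> g) = relabel_mtx S \<sigma> (block S' g)"
  "block T (relabel_mtx (S \<union> T) \<rho> g) = relabel_mtx T \<tau> (block T' g)"
  using rho(3-6) by (auto simp: block_def relabel_mtx_def fun_eq_iff)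

private lemma times_subset_pullback:
  assumes "R \<in> posets (S' \<union> T')"
  shows "S \<times> T \<subseteq> pullback (S \<union> T) \<rho> R \<longleftrightarrow> S' \<times> T' \<subseteq> R"
  unfolding img[symmetric] by (auto simp: pullback_def rho(3,4) subset_iff)

lemma fp_mult_natural:
  "fp_act (S \<union> T) (union_map S \<sigma> \<tau>) (fp_mult S T t) =
   fp_mult S' T' ((fp_act S \<sigma> \<otimes>\<^sub>m fp_act T \<tau>) t)"
proof (intro ext, clarify)
  fix R and g :: "('a, 'b) mtx"
  show "fp_act (S \<union> T) \<rho> (fp_mult S T t) (R, g) =
        fp_mult S' T' ((fp_act S \<sigma> \<otimes>\<^sub>m fp_act T \<tau>) t) (R, g)"
  proof (cases "R \<in> posets (S' \<union> T') \<and> g \<in> pattern_group (S' \<union> T') R")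
    case True
    hence "pullback (S \<union> T) \<rho> R \<in> posets (S \<union> T)"
      "relabel_mtx (S \<union> T) \<rho> g \<in> pattern_group (S \<union> T) (pullback (S \<union> T) \<rho> R)"
      using pullback_posets relabel_pattern_group rho(1,2) by metis+
    moreover have "Restr R S' \<in> posets S'" "Restr R T' \<in> posets T'"
      "block S' g \<in> pattern_group S' (Restr R S')" "block T' g \<in> pattern_group T' (Restr R T')"
      using True by (auto intro: Restr_posets[of _ "S' \<union> T'"] block_pattern_group[of _ "S' \<union> T'"])
    ultimately show ?thesis
      using True by (simp add: fp_act_apply fp_mult_apply tensor_map_def fin fin' disj rho(1,2)
          inj img Restr_pullback block_relabel times_subset_pullback)
  qed (use fin fin' disj rho(1,2) in \<open>auto simp: fp_act_apply fp_mult_apply\<close>)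
qed

private lemma pullback_glueings:
  assumes "R \<in> glueings S' T' P Q"
  shows "pullback (S \<union> T) \<rho> R \<in> glueings S T (pullback S \<sigma> P) (pullback T \<tau> Q)"
  using assms pullback_posets[of R \<rho> "S \<union> T"] rho(1,2) Restr_pullback
  by (auto simp: glueings_def)

private lemma map_prod_glueings:
  assumes "R \<in> glueings S T (pullback S \<sigma> P) (pullback T \<tau> Q)" "P \<in> posets S'" "Q \<in> posets T'"
  shows "map_prod \<rho> \<rho> ` R \<in> glueings S' T' P Q"
proof -
  let ?R = "map_prod \<rho> \<rho> ` R"
  have R: "R \<in> posets (S \<union> T)" using assms(1) by (simp add: glueings_def)
  hence R': "?R \<in> posets (S' \<union> T')" using map_prod_posets rho(1,2) by metis
  have "pullback (S \<union> T) \<rho> ?R = R" by (rule pullback_map_prod[OF R rho(1)])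
  \<comment> \<open>Pulling back is injective on posets over the image, so it is enough to compare
    the restrictions after pullback, where \<open>Restr_pullback\<close> turns them into
    restrictions of R.\<close>
  hence "pullback S \<sigma> (Restr ?R S') = pullback S \<sigma> P" "pullback T \<tau> (Restr ?R T') = pullback T \<tau> Q"
    using assms(1) by (auto simp: glueings_def simp flip: Restr_pullback)
  moreover have "Restr ?R S' \<in> posets S'" "Restr ?R T' \<in> posets T'"
    using R' by (auto intro: Restr_posets[of _ "S' \<union> T'"])
  ultimately have "Restr ?R S' = P" "Restr ?R T' = Q"
    using assms(2,3) img map_prod_pullback by metis+
  thus ?thesis using R' by (simp add: glueings_def)
qed

text \<open>Pullback along \<open>union_map S \<sigma> \<tau>\<close> carries the glueings of P and
  Q bijectively to those of their pullbacks. The matrices agree because the union map sends S into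
  S' and T into T', so that relabelling respects the two blocks.\<close>

lemma fp_comult_natural:
  "(fp_act S \<sigma> \<otimes>\<^sub>m fp_act T \<tau>) (fp_comult S T x) =
   fp_comult S' T' (fp_act (S \<union> T) (union_map S \<sigma> \<tau>) x)"
proof (intro ext, clarify)
  fix P Q and g h :: "('a, 'b) mtx"
  let ?L = "(fp_act S \<sigma> \<otimes>\<^sub>m fp_act T \<tau>) (fp_comult S T x) ((P, g), (Q, h))"
  let ?R = "fp_comult S' T' (fp_act (S \<union> T) \<rho> x) ((P, g), (Q, h))"
  show "?L = ?R"
  proof (cases "P \<in> posets S' \<and> Q \<in> posets T' \<and> g \<in> pattern_group S' P \<and> h \<in> pattern_group T' Q")
    case True
    have "relabel_mtx S \<sigma> g \<in> pattern_group S (pullback S \<sigma> P)"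
      "relabel_mtx T \<tau> h \<in> pattern_group T (pullback T \<tau> Q)"
      using True relabel_pattern_group inj img by metis+
    hence "?L = (\<Sum>R\<in>glueings S T (pullback S \<sigma> P) (pullback T \<tau> Q).
        x (R, block_sum S T (relabel_mtx S \<sigma> g) (relabel_mtx T \<tau> h)))"
      using True fin inj img by (simp add: tensor_map_def fp_act_apply fp_comult_apply)
    also have "\<dots> = (\<Sum>R\<in>glueings S' T' P Q.
        x (pullback (S \<union> T) \<rho> R, relabel_mtx (S \<union> T) \<rho> (block_sum S' T' g h)))"
    proof (rule sum.reindex_bij_witness[where i = "pullback (S \<union> T) \<rho>" and j = "(`) (map_prod \<rho> \<rho>)"])
      fix R assume R: "R \<in> glueings S T (pullback S \<sigma> P) (pullback T \<tau> Q)"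
      show *: "pullback (S \<union> T) \<rho> (map_prod \<rho> \<rho> ` R) = R"
        using R by (intro pullback_map_prod rho(1)) (simp add: glueings_def)
      show "map_prod \<rho> \<rho> ` R \<in> glueings S' T' P Q"
        using True R map_prod_glueings by blast
      have "i \<in> S \<Longrightarrow> \<sigma> i \<notin> T'" "i \<in> T \<Longrightarrow> \<tau> i \<notin> S'" "i \<in> T \<Longrightarrow> i \<notin> S" for i
        using disj rho(5,6) by auto
      note simps = this rho(3-6)
      hence "relabel_mtx (S \<union> T) \<rho> (block_sum S' T' g h) =
          block_sum S T (relabel_mtx S \<sigma> g) (relabel_mtx T \<tau> h)"
      proof (intro ext)
        fix i j
        show "relabel_mtx (S \<union> T) \<rho> (block_sum S' T' g h) i j =
            block_sum S T (relabel_mtx S \<sigma> g) (relabel_mtx T \<tau> h) i j"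
          unfolding relabel_mtx_def block_sum_def
          by (cases "i \<in> S"; cases "j \<in> S"; cases "i \<in> T"; cases "j \<in> T") (simp_all add: simps)
      qed
      thus "x (pullback (S \<union> T) \<rho> (map_prod \<rho> \<rho> ` R), relabel_mtx (S \<union> T) \<rho> (block_sum S' T' g h)) =
         x (R, block_sum S T (relabel_mtx S \<sigma> g) (relabel_mtx T \<tau> h))"
        by (simp add: *)
    next
      fix R assume R: "R \<in> glueings S' T' P Q"
      show "pullback (S \<union> T) \<rho> R \<in> glueings S T (pullback S \<sigma> P) (pullback T \<tau> Q)"
        by (rule pullback_glueings[OF R])
      show "map_prod \<rho> \<rho> ` pullback (S \<union> T) \<rho> R = R"
        using R rho(2) by (intro map_prod_pullback) (simp add: glueings_def)
    qed
    also have "\<dots> = (\<Sum>R\<in>glueings S' T' P Q. fp_act (S \<union> T) \<rho> x (R, block_sum S' T' g h))"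
    proof (rule sum.cong[OF refl])
      fix R assume R: "R \<in> glueings S' T' P Q"
      hence "block_sum S' T' g h \<in> pattern_group (S' \<union> T') R"
        using True disj(2) by (intro block_sum_pattern_group) (auto simp: glueings_def)
      thus "x (pullback (S \<union> T) \<rho> R, relabel_mtx (S \<union> T) \<rho> (block_sum S' T' g h)) =
          fp_act (S \<union> T) \<rho> x (R, block_sum S' T' g h)"
        using R fin rho(1,2) by (simp add: fp_act_apply glueings_def)
    qed
    also have "\<dots> = ?R" using True by (simp add: fp_comult_apply fin')
    finally show ?thesis .
  next
    case False
    have "?L = 0"
      using False by (auto simp: tensor_map_def fp_act_apply inj img fin)
    moreover have "?R = 0"
      using False glueings_posets(2,3)[of _ S' T' P Q]
      by (auto simp: fp_comult_apply fin' intro!: sum.neutral)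
    ultimately show ?thesis by simp
  qed
qed

end

section \<open>Associativity and coassociativity\<close>

lemma fp_mult_assoc:
  assumes "finite R" "finite S" "finite T" "R \<inter> S = {}" "R \<inter> T = {}" "S \<inter> T = {}"
  shows "fp_mult (R \<union> S) T ((fp_mult R S \<otimes>\<^sub>m id) w) =
         fp_mult R (S \<union> T) ((id \<otimes>\<^sub>m fp_mult S T) (tensor_assoc w))"
proof (intro ext, clarify)
  fix Z and g :: "('a, 'b) mtx"
  show "fp_mult (R \<union> S) T ((fp_mult R S \<otimes>\<^sub>m id) w) (Z, g) =
        fp_mult R (S \<union> T) ((id \<otimes>\<^sub>m fp_mult S T) (tensor_assoc w)) (Z, g)"
  proof (cases "Z \<in> posets (R \<union> S \<union> T) \<and> g \<in> pattern_group (R \<union> S \<union> T) Z")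
    case True
    hence "Restr Z (R \<union> S) \<in> posets (R \<union> S)" "Restr Z (S \<union> T) \<in> posets (S \<union> T)"
      "block (R \<union> S) g \<in> pattern_group (R \<union> S) (Restr Z (R \<union> S))"
      "block (S \<union> T) g \<in> pattern_group (S \<union> T) (Restr Z (S \<union> T))"
      by (auto intro: Restr_posets[of _ "R \<union> S \<union> T"] block_pattern_group[of _ "R \<union> S \<union> T"])
    \<comment> \<open>Either bracketing imposes the same three containments of R \<times> S, R
      \<times> T and S \<times> T in Z, and then evaluates \<open>w\<close> at the three diagonal
      blocks.\<close>
    moreover have "R \<times> S \<subseteq> Restr Z (R \<union> S) \<longleftrightarrow> R \<times> S \<subseteq> Z" "S \<times> T \<subseteq> Restr Z (S \<union> T) \<longleftrightarrow> S \<times> T \<subseteq> Z"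
      by auto
    moreover have "(R \<union> S) \<inter> T = {}" "R \<inter> (S \<union> T) = {}" using assms by auto
    moreover have "(R \<union> S) \<times> T \<subseteq> Z \<longleftrightarrow> R \<times> T \<subseteq> Z \<and> S \<times> T \<subseteq> Z"
      "R \<times> (S \<union> T) \<subseteq> Z \<longleftrightarrow> R \<times> S \<subseteq> Z \<and> R \<times> T \<subseteq> Z" by auto
    ultimately show ?thesis
      using True assms
      by (auto simp: fp_mult_apply tensor_map_def tensor_assoc_def Restr_Restr block_block Un_assoc
          simp del: Int_Un_distrib Int_Un_distrib2)
  next
    case False
    have "(R \<union> S) \<inter> T = {}" "R \<inter> (S \<union> T) = {}" using assms by auto
    thus ?thesis using False assms by (auto simp: fp_mult_apply Un_assoc)
  qed
qed

text \<open>The intermediate poset Z' can only be the restriction of Z to R \<union> S, so the inner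
  index sets are disjoint. The right side treats R, S and T alike, which lets the lemma serve both
  bracketings.\<close>

lemma sum_glueings_left:
  assumes "finite R" "finite S" "finite T"
  shows "(\<Sum>Z'\<in>glueings R S P1 P2. \<Sum>Z\<in>glueings (R \<union> S) T Z' P3. f Z) =
    (\<Sum>Z | Z \<in> posets (R \<union> S \<union> T) \<and> Restr Z R = P1 \<and> Restr Z S = P2 \<and> Restr Z T = P3. f Z)"
proof -
  have "(\<Union>Z'\<in>glueings R S P1 P2. glueings (R \<union> S) T Z' P3) =
      {Z \<in> posets (R \<union> S \<union> T). Restr Z R = P1 \<and> Restr Z S = P2 \<and> Restr Z T = P3}"
  proof (intro equalityI subsetI)
    fix Z assume "Z \<in> {Z \<in> posets (R \<union> S \<union> T). Restr Z R = P1 \<and> Restr Z S = P2 \<and> Restr Z T = P3}"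
    moreover from this have "Restr Z (R \<union> S) \<in> posets (R \<union> S)"
      by (intro Restr_posets[of _ "R \<union> S \<union> T"]) auto
    ultimately show "Z \<in> (\<Union>Z'\<in>glueings R S P1 P2. glueings (R \<union> S) T Z' P3)"
      by (auto simp: glueings_def Restr_Restr)
  qed (auto simp: glueings_def Restr_Restr)
  moreover have "(\<Sum>Z\<in>(\<Union>Z'\<in>glueings R S P1 P2. glueings (R \<union> S) T Z' P3). f Z) =
      (\<Sum>Z'\<in>glueings R S P1 P2. \<Sum>Z\<in>glueings (R \<union> S) T Z' P3. f Z)"
    using assms by (intro sum.UNION_disjoint ballI impI finite_glueings finite_UnI)
      (auto simp: glueings_def)
  ultimately show ?thesis by simp
qed

lemma glueings_commute: "glueings S T P Q = glueings T S Q P"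
  by (auto simp: glueings_def Un_commute)

lemma fp_comult_coassoc:
  assumes "finite R" "finite S" "finite T" "R \<inter> S = {}" "R \<inter> T = {}" "S \<inter> T = {}"
  shows "tensor_assoc ((fp_comult R S \<otimes>\<^sub>m id) (fp_comult (R \<union> S) T x)) =
         (id \<otimes>\<^sub>m fp_comult S T) (fp_comult R (S \<union> T) x)"
proof (intro ext, clarify)
  fix P1 P2 P3 and g1 g2 g3 :: "('a, 'b) mtx"
  let ?L = "tensor_assoc ((fp_comult R S \<otimes>\<^sub>m id) (fp_comult (R \<union> S) T x))
    ((P1, g1), (P2, g2), (P3, g3))"
  let ?R = "(id \<otimes>\<^sub>m fp_comult S T) (fp_comult R (S \<union> T) x) ((P1, g1), (P2, g2), (P3, g3))"
  show "?L = ?R"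
  proof (cases "g1 \<in> pattern_group R P1 \<and> g2 \<in> pattern_group S P2 \<and> g3 \<in> pattern_group T P3")
    case True
    let ?f = "\<lambda>Z. x (Z, block_sum (R \<union> S) T (block_sum R S g1 g2) g3)"
    have "?L = (\<Sum>Z'\<in>glueings R S P1 P2. \<Sum>Z\<in>glueings (R \<union> S) T Z' P3. ?f Z)"
    proof -
      have "block_sum R S g1 g2 \<in> pattern_group (R \<union> S) Z'" if "Z' \<in> glueings R S P1 P2" for Z'
        using that True assms by (intro block_sum_pattern_group) (auto simp: glueings_def)
      thus ?thesis
        using True assms by (simp add: tensor_assoc_def tensor_map_def fp_comult_apply)
    qed
    also have "\<dots> = (\<Sum>Z | Z \<in> posets (R \<union> S \<union> T) \<and>
        Restr Z R = P1 \<and> Restr Z S = P2 \<and> Restr Z T = P3. ?f Z)"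
      by (rule sum_glueings_left) (use assms in auto)
    \<comment> \<open>Rotating the three sets prepares the use of \<open>sum_glueings_left\<close>
      for the bracketing in which S and T are glued before R.\<close>
    also have "\<dots> = (\<Sum>Z | Z \<in> posets (S \<union> T \<union> R) \<and>
        Restr Z S = P2 \<and> Restr Z T = P3 \<and> Restr Z R = P1. ?f Z)"
      by (rule sum.cong) (auto simp: Un_ac)
    also have "\<dots> = (\<Sum>Z'\<in>glueings S T P2 P3. \<Sum>Z\<in>glueings (S \<union> T) R Z' P1. ?f Z)"
      by (rule sum_glueings_left[symmetric]) (use assms in auto)
    also have "\<dots> = (\<Sum>Z'\<in>glueings S T P2 P3. \<Sum>Z\<in>glueings R (S \<union> T) P1 Z'. ?f Z)"
      by (simp only: glueings_commute[of R "S \<union> T"])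
    also have "\<dots> = ?R"
    proof -
      have "block_sum S T g2 g3 \<in> pattern_group (S \<union> T) Z'" if "Z' \<in> glueings S T P2 P3" for Z'
        using that True assms by (intro block_sum_pattern_group) (auto simp: glueings_def)
      moreover have "block_sum (R \<union> S) T (block_sum R S g1 g2) g3 =
          block_sum R (S \<union> T) g1 (block_sum S T g2 g3)"
        using assms(4-6) by (auto simp: block_sum_def fun_eq_iff)
      ultimately show ?thesis
        using True assms by (simp add: tensor_map_def fp_comult_apply)
    qed
    finally show ?thesis .
  qed (use assms in \<open>auto simp: tensor_assoc_def tensor_map_def fp_comult_apply\<close>)
qed

section \<open>Compatibility of the product with the coproduct\<close>

context
  fixes S1 S2 T1 T2 A B C D :: "'a set"
  assumes union: "S1 \<union> S2 = T1 \<union> T2"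
    and disj: "S1 \<inter> S2 = {}" "T1 \<inter> T2 = {}"
    and ABCD: "A = S1 \<inter> T1" "B = S1 \<inter> T2" "C = S2 \<inter> T1" "D = S2 \<inter> T2"
begin

private lemma parts: "S1 = A \<union> B" "S2 = C \<union> D" "T1 = A \<union> C" "T2 = B \<union> D"
  and parts_disj: "A \<inter> B = {}" "C \<inter> D = {}" "A \<inter> C = {}" "B \<inter> D = {}" "A \<inter> D = {}" "B \<inter> C = {}"
  using union disj unfolding ABCD by blast+

private lemma Restr_Restr_Int:
  "Restr (Restr R S1) A = Restr (Restr R T1) A" "Restr (Restr R S1) B = Restr (Restr R T2) B"
  "Restr (Restr R S2) C = Restr (Restr R T1) C" "Restr (Restr R S2) D = Restr (Restr R T2) D"
  unfolding ABCD by auto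

text \<open>On T1 the ordinal sum has the relations of P within A and within C, and every relation
  from A to C. It is \<open>A \<times> C \<subseteq> P\<close> that makes this equal to P instead of
  a larger relation; T2 is treated alike.\<close>

private lemma glueings_ordinal_sum:
  assumes R1: "R1 \<in> glueings A B (Restr P A) (Restr Q B)"
    and R2: "R2 \<in> glueings C D (Restr P C) (Restr Q D)"
    and P: "P \<in> posets T1" "A \<times> C \<subseteq> P" and Q: "Q \<in> posets T2" "B \<times> D \<subseteq> Q"
  shows "ordinal_sum S1 S2 R1 R2 \<in> glueings T1 T2 P Q"
proof -
  note R1' = glueings_posets[OF R1] and R2' = glueings_posets[OF R2]
  let ?R = "ordinal_sum S1 S2 R1 R2"
  have R: "?R \<in> posets (S1 \<union> S2)"
    using R1'(1) R2'(1) disj(1) parts by (intro ordinal_sum_posets) auto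
  have sub: "R1 \<subseteq> S1 \<times> S1" "R2 \<subseteq> S2 \<times> S2"
    using posets_subset[OF R1'(1)] posets_subset[OF R2'(1)] parts by auto
  have "Restr ?R T1 = Restr R1 A \<union> Restr R2 C \<union> A \<times> C"
    using sub unfolding ordinal_sum_def ABCD by blast
  also have "\<dots> = ordinal_sum A C (Restr P A) (Restr P C)"
    using R1'(4) R2'(4) by (simp add: ordinal_sum_def)
  also have "\<dots> = P"
    using P parts parts_disj by (intro ordinal_sum_Restr) auto
  finally have 1: "Restr ?R T1 = P" .
  have "Restr ?R T2 = Restr R1 B \<union> Restr R2 D \<union> B \<times> D"
    using sub unfolding ordinal_sum_def ABCD by blast
  also have "\<dots> = ordinal_sum B D (Restr Q B) (Restr Q D)"
    using R1'(5) R2'(5) by (simp add: ordinal_sum_def)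
  also have "\<dots> = Q"
    using Q parts parts_disj by (intro ordinal_sum_Restr) auto
  finally have 2: "Restr ?R T2 = Q" .
  show ?thesis using R 1 2 union by (simp add: glueings_def)
qed

private lemma glueings_Restr:
  assumes "R \<in> glueings T1 T2 P Q"
  shows "Restr R S1 \<in> glueings A B (Restr P A) (Restr Q B)"
    "Restr R S2 \<in> glueings C D (Restr P C) (Restr Q D)"
proof -
  have "R \<in> posets (S1 \<union> S2)" using assms union by (simp add: glueings_def)
  hence "Restr R S1 \<in> posets (A \<union> B)" "Restr R S2 \<in> posets (C \<union> D)"
    unfolding parts(1,2)[symmetric] by (auto intro: Restr_posets[of _ "S1 \<union> S2"])
  thus "Restr R S1 \<in> glueings A B (Restr P A) (Restr Q B)"
    "Restr R S2 \<in> glueings C D (Restr P C) (Restr Q D)"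
    using glueings_posets(4,5)[OF assms] Restr_Restr_Int[of R] unfolding glueings_def by auto
qed

private lemma block_block_sum:
  "block S1 (block_sum T1 T2 g h) = block_sum A B (block A g) (block B h)"
  "block S2 (block_sum T1 T2 g h) = block_sum C D (block C g) (block D h)"
  using disj unfolding ABCD block_def block_sum_def fun_eq_iff by auto

text \<open>Restriction to S1 and S2 maps the glueings R of P and Q with
  \<open>S1 \<times> S2 \<subseteq> R\<close> bijectively to pairs of glueings over (A, B) and (C,
  D), with the ordinal sum as inverse. The left side sums over the former, the right side over the
  latter.\<close>

lemma fp_compatible:
  assumes fin: "finite (S1 \<union> S2)"
  shows "fp_comult T1 T2 (fp_mult S1 S2 t) =
    (fp_mult A C \<otimes>\<^sub>m fp_mult B D) (tensor_swap ((fp_comult A B \<otimes>\<^sub>m fp_comult C D) t))"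
proof (intro ext, clarify)
  fix P Q and g h :: "('a, 'b) mtx"
  have fins: "finite S1" "finite S2" "finite T1" "finite T2" "finite A" "finite B" "finite C" "finite D"
    using fin fin[unfolded union] unfolding ABCD by auto
  let ?L = "fp_comult T1 T2 (fp_mult S1 S2 t) ((P, g), (Q, h))"
  let ?R = "(fp_mult A C \<otimes>\<^sub>m fp_mult B D) (tensor_swap ((fp_comult A B \<otimes>\<^sub>m fp_comult C D) t))
    ((P, g), (Q, h))"
  let ?t = "\<lambda>R1 R2. t ((R1, block_sum A B (block A g) (block B h)),
    (R2, block_sum C D (block C g) (block D h)))"
  show "?L = ?R"
  proof (cases "g \<in> pattern_group T1 P \<and> h \<in> pattern_group T2 Q")
    case True
    have "?L = (\<Sum>R\<in>glueings T1 T2 P Q. if S1 \<times> S2 \<subseteq> R then ?t (Restr R S1) (Restr R S2) else 0)"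
    proof -
      have "R \<in> posets (S1 \<union> S2) \<and> block_sum T1 T2 g h \<in> pattern_group (S1 \<union> S2) R"
        if "R \<in> glueings T1 T2 P Q" for R
        using that True union disj block_sum_pattern_group[of g T1 R h T2]
        by (auto simp: glueings_def)
      thus ?thesis
        using True fins disj by (simp add: fp_comult_apply fp_mult_apply block_block_sum cong: if_cong)
    qed
    also have "\<dots> = (\<Sum>R | R \<in> glueings T1 T2 P Q \<and> S1 \<times> S2 \<subseteq> R. ?t (Restr R S1) (Restr R S2))"
      by (simp add: sum.inter_filter finite_glueings fins)
    also have "\<dots> = ?R"
    \<comment> \<open>Outside this case both sides vanish: the right one by the support of the two
      products, the left one because \<open>S1 \<times> S2 \<subseteq> R\<close> restricts to the
      two containments and glueings exist only for posets.\<close>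
    proof (cases "P \<in> posets T1 \<and> Q \<in> posets T2 \<and> A \<times> C \<subseteq> P \<and> B \<times> D \<subseteq> Q")
      case PQ: True
      let ?G = "glueings A B (Restr P A) (Restr Q B) \<times> glueings C D (Restr P C) (Restr Q D)"
      have "(\<Sum>R | R \<in> glueings T1 T2 P Q \<and> S1 \<times> S2 \<subseteq> R. ?t (Restr R S1) (Restr R S2)) =
          (\<Sum>(R1, R2)\<in>?G. ?t R1 R2)"
      proof (rule sum.reindex_bij_witness[where i = "\<lambda>(R1, R2). ordinal_sum S1 S2 R1 R2"
            and j = "\<lambda>R. (Restr R S1, Restr R S2)"])
        fix R assume R: "R \<in> {R \<in> glueings T1 T2 P Q. S1 \<times> S2 \<subseteq> R}"
        hence "ordinal_sum S1 S2 (Restr R S1) (Restr R S2) = R"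
          using disj union by (intro ordinal_sum_Restr) (auto simp: glueings_def)
        thus "(case (Restr R S1, Restr R S2) of (R1, R2) \<Rightarrow> ordinal_sum S1 S2 R1 R2) = R" by simp
        show "(Restr R S1, Restr R S2) \<in> ?G" using R glueings_Restr by blast
      next
        fix X assume "X \<in> ?G"
        then obtain R1 R2 where X: "X = (R1, R2)"
          and R1: "R1 \<in> glueings A B (Restr P A) (Restr Q B)"
          and R2: "R2 \<in> glueings C D (Restr P C) (Restr Q D)" by auto
        have "R1 \<in> posets S1" "R2 \<in> posets S2"
          using glueings_posets(1)[OF R1] glueings_posets(1)[OF R2] parts by auto
        thus "(Restr (case X of (R1, R2) \<Rightarrow> ordinal_sum S1 S2 R1 R2) S1,
            Restr (case X of (R1, R2) \<Rightarrow> ordinal_sum S1 S2 R1 R2) S2) = X"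
          by (simp add: X Restr_ordinal_sum disj)
        show "(case X of (R1, R2) \<Rightarrow> ordinal_sum S1 S2 R1 R2) \<in>
            {R \<in> glueings T1 T2 P Q. S1 \<times> S2 \<subseteq> R}"
          using glueings_ordinal_sum[OF R1 R2] PQ by (auto simp: X ordinal_sum_def)
      qed simp
      also have "\<dots> = (\<Sum>R1\<in>glueings A B (Restr P A) (Restr Q B).
          \<Sum>R2\<in>glueings C D (Restr P C) (Restr Q D). ?t R1 R2)"
        by (simp add: sum.cartesian_product)
      also have "\<dots> = ?R"
      proof -
        have "block A g \<in> pattern_group A (Restr P A)" "block B h \<in> pattern_group B (Restr Q B)"
          "block C g \<in> pattern_group C (Restr P C)" "block D h \<in> pattern_group D (Restr Q D)"
          using True parts by (auto intro: block_pattern_group)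
        thus ?thesis
          using True PQ fins parts(3,4) parts_disj
          by (simp add: tensor_map_def tensor_swap_def fp_mult_apply fp_comult_apply)
      qed
      finally show ?thesis .
    next
      case PQ: False
      have "A \<times> C \<subseteq> P \<and> B \<times> D \<subseteq> Q" if "R \<in> glueings T1 T2 P Q" "S1 \<times> S2 \<subseteq> R" for R
        using glueings_posets(4,5)[OF that(1)] that(2) parts by blast
      hence "{R \<in> glueings T1 T2 P Q. S1 \<times> S2 \<subseteq> R} = {}"
        using PQ glueings_posets(2,3)[of _ T1 T2 P Q] by blast
      moreover have "?R = 0"
        using PQ True fins parts(3,4) parts_disj by (auto simp: tensor_map_def fp_mult_apply)
      ultimately show ?thesis by (simp only: sum.empty)
    qed
    finally show ?thesis .
  next
    case False
    thus ?thesis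
      using fins parts(3,4) parts_disj by (auto simp: tensor_map_def fp_mult_apply fp_comult_apply)
  qed
qed

end


section \<open>Tensor products of spaces of functions\<close>

text \<open>
  The expansion of a tensor along its first argument in the reproducing family \<open>e\<close> has the slices
  of the tensor as coefficients.
\<close>

lemma tensor_iff_slices:
  fixes V :: "('b \<Rightarrow> complex) set" and W :: "('c \<Rightarrow> complex) set"
  assumes V: "cfun.subspace V" and W: "cfun.subspace W"
    and X: "finite X" "\<And>x. x \<in> X \<Longrightarrow> e x \<in> V"
    and repr: "\<And>v y. v \<in> V \<Longrightarrow> v y = (\<Sum>x\<in>X. v x * e x y)"
  shows "t \<in> V \<otimes>\<^sub>s W \<longleftrightarrow> (\<forall>y. (\<lambda>x. t (x, y)) \<in> V) \<and> (\<forall>x. (\<lambda>y. t (x, y)) \<in> W)"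
proof
  assume "t \<in> V \<otimes>\<^sub>s W"
  thus "(\<forall>y. (\<lambda>x. t (x, y)) \<in> V) \<and> (\<forall>x. (\<lambda>y. t (x, y)) \<in> W)"
    unfolding tensor_def
  proof (induction rule: cfun.span_induct_alt)
    case base
    show ?case using cfun.subspace_0[OF V] cfun.subspace_0[OF W] by (simp add: zero_fun_def)
  next
    case (step c b t)
    then obtain v w where b: "b = v \<otimes>\<^sub>v w" "v \<in> V" "w \<in> W" by auto
    have "(\<lambda>x. (cscale c b + t) (x, y)) = cscale (c * w y) v + (\<lambda>x. t (x, y))" for y
      by (auto simp: b pure_tensor_def cscale_def)
    moreover have "(\<lambda>y. (cscale c b + t) (x, y)) = cscale (c * v x) w + (\<lambda>y. t (x, y))" for x
      by (auto simp: b pure_tensor_def cscale_def)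
    ultimately show ?case
      using step b by (auto intro!: cfun.subspace_add cfun.subspace_scale V W)
  qed
next
  assume t: "(\<forall>y. (\<lambda>x. t (x, y)) \<in> V) \<and> (\<forall>x. (\<lambda>y. t (x, y)) \<in> W)"
  have "t = (\<Sum>x\<in>X. e x \<otimes>\<^sub>v (\<lambda>y. t (x, y)))"
  proof (intro ext, clarify)
    fix x y
    show "t (x, y) = (\<Sum>x\<in>X. e x \<otimes>\<^sub>v (\<lambda>y. t (x, y))) (x, y)"
      using repr[of "\<lambda>x. t (x, y)" x] t by (simp add: sum_apply pure_tensor_def mult.commute)
  qed
  also have "\<dots> \<in> V \<otimes>\<^sub>s W"
    unfolding tensor_def using t X(2) by (intro cfun.span_sum cfun.span_base) blast
  finally show "t \<in> V \<otimes>\<^sub>s W" .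
qed

text \<open>
  The reproducing family consists of the normalised indicator functions of the classes of points
  that no function in \<open>V\<close> separates.
\<close>

lemma reproducing_family:
  fixes X :: "'b set" and R :: "'b rel"
  defines "V \<equiv> {v. (\<forall>x. x \<notin> X \<longrightarrow> v x = (0::complex)) \<and> (\<forall>(x, y)\<in>R. v x = v y)}"
  assumes "finite X" "R \<subseteq> X \<times> X"
  obtains e where "\<And>x. x \<in> X \<Longrightarrow> e x \<in> V" "\<And>v y. v \<in> V \<Longrightarrow> v y = (\<Sum>x\<in>X. v x * e x y)"
proof
  \<comment> \<open>Defined through V, this is an equivalence relation for any R, and related points
    are equivalent.\<close>
  define eq where "eq x y \<longleftrightarrow> (\<forall>v\<in>V. v x = v y)" for x y
  define cls where "cls y = {x \<in> X. eq x y}" for y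
  define e :: "'b \<Rightarrow> 'b \<Rightarrow> complex"
    where "e x y = (if y \<in> X \<and> eq x y then 1 / of_nat (card (cls x)) else 0)" for x y
  have "v x = v y" if "(x, y) \<in> R" "v \<in> V" for v x y
    using that by (auto simp: V_def)
  hence "eq z x \<longleftrightarrow> eq z y" if "(x, y) \<in> R" for x y z
    using that unfolding eq_def by metis
  thus "e x \<in> V" if "x \<in> X" for x
    using that assms(3) unfolding V_def e_def by auto
  fix v y assume v: "v \<in> V"
  show "v y = (\<Sum>x\<in>X. v x * e x y)"
  proof (cases "y \<in> X")
    case True
    have "cls x = cls y" "v x = v y" if "eq x y" for x
      using that v by (auto simp: cls_def eq_def)
    \<comment> \<open>The sum is the average of v over the class of y, on which v is
      constant.\<close>
    hence "(\<Sum>x\<in>X. v x * e x y) = (\<Sum>x\<in>X. if eq x y then v y / of_nat (card (cls y)) else 0)"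
      using True by (intro sum.cong) (auto simp: e_def)
    also have "\<dots> = (\<Sum>x\<in>cls y. v y / of_nat (card (cls y)))"
      unfolding cls_def by (rule sum.inter_filter[symmetric, OF assms(2)])
    also have "\<dots> = v y"
    proof -
      have "y \<in> cls y" using True by (simp add: cls_def eq_def)
      hence "card (cls y) \<noteq> 0" using assms(2) by (auto simp: cls_def)
      thus ?thesis by simp
    qed
    finally show ?thesis ..
  next
    case False
    thus ?thesis using v by (simp add: e_def V_def)
  qed
qed


section \<open>Hopf monoids from relations on pattern groups\<close>

definition invariant_funs ::
  "('a set \<Rightarrow> 'a rel \<Rightarrow> ('a, 'k::field) mtx \<Rightarrow> ('a, 'k) mtx \<Rightarrow> bool) \<Rightarrow>
   'a set \<Rightarrow> 'a rel \<Rightarrow> (('a, 'k) mtx \<Rightarrow> complex) set" where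
  "invariant_funs rel I P = {\<alpha> \<in> funs_on (pattern_group I P).
     \<forall>g\<in>pattern_group I P. \<forall>h\<in>pattern_group I P. rel I P g h \<longrightarrow> \<alpha> g = \<alpha> h}"

text \<open>A bare relation fits both applications: equality of \<open>sml\<close> for the
  nonnesting superclasses, and membership in the superclass of one common matrix for the algebra
  group superclasses.\<close>

locale pattern_relation =
  fixes rel :: "'a set \<Rightarrow> 'a rel \<Rightarrow> ('a, 'k::{field,finite}) mtx \<Rightarrow> ('a, 'k) mtx \<Rightarrow> bool"
  assumes rel_relabel:
      "\<lbrakk>finite I; inj_on \<sigma> I; P \<in> posets (\<sigma> ` I);
        g \<in> pattern_group (\<sigma> ` I) P; h \<in> pattern_group (\<sigma> ` I) P; rel (\<sigma> ` I) P g h\<rbrakk>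
       \<Longrightarrow> rel I (pullback I \<sigma> P) (relabel_mtx I \<sigma> g) (relabel_mtx I \<sigma> h)"
    and rel_block:
      "\<lbrakk>finite I; P \<in> posets I; C \<subseteq> I;
        \<And>i j k. i \<in> C \<Longrightarrow> j \<in> C \<Longrightarrow> (i, k) \<in> P \<Longrightarrow> (k, j) \<in> P \<Longrightarrow> k \<in> C;
        g \<in> pattern_group I P; h \<in> pattern_group I P; rel I P g h\<rbrakk>
       \<Longrightarrow> rel C (Restr P C) (block C g) (block C h)"
    and rel_block_sum:
      "\<lbrakk>finite S; finite T; S \<inter> T = {}; R \<in> posets (S \<union> T);
        g \<in> pattern_group S (Restr R S); g' \<in> pattern_group S (Restr R S);
        h \<in> pattern_group T (Restr R T); rel S (Restr R S) g g'\<rbrakk>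
       \<Longrightarrow> rel (S \<union> T) R (block_sum S T g h) (block_sum S T g' h)"
begin

abbreviation pvecs :: "'a set \<Rightarrow> ('a, 'k) pvec set" where
  "pvecs I \<equiv> poset_sum I (invariant_funs rel I)"

lemma pvecs_iff:
  "v \<in> pvecs I \<longleftrightarrow>
     (\<forall>P g. \<not> (P \<in> posets I \<and> g \<in> pattern_group I P) \<longrightarrow> v (P, g) = 0) \<and>
     (\<forall>P\<in>posets I. \<forall>g\<in>pattern_group I P. \<forall>h\<in>pattern_group I P. rel I P g h \<longrightarrow> v (P, g) = v (P, h))"
  by (auto simp: poset_sum_def invariant_funs_def funs_on_def)

lemma pvecs_zero:
  "v \<in> pvecs I \<Longrightarrow> \<not> (P \<in> posets I \<and> g \<in> pattern_group I P) \<Longrightarrow> v (P, g) = 0"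
  unfolding pvecs_iff by blast

lemma pvecs_eq:
  "\<lbrakk>v \<in> pvecs I; P \<in> posets I; g \<in> pattern_group I P; h \<in> pattern_group I P; rel I P g h\<rbrakk>
   \<Longrightarrow> v (P, g) = v (P, h)"
  unfolding pvecs_iff by blast

lemma pvecs_subspace: "cfun.subspace (pvecs I)"
proof (rule cfun.subspaceI)
  show "0 \<in> pvecs I" by (simp add: pvecs_iff)
  show "v + w \<in> pvecs I" if "v \<in> pvecs I" "w \<in> pvecs I" for v w
    unfolding pvecs_iff plus_fun_apply
    using that by (auto simp: pvecs_zero intro!: arg_cong2[where f = "(+)"] pvecs_eq)
  show "cscale c v \<in> pvecs I" if "v \<in> pvecs I" for c v
    unfolding pvecs_iff cscale_def
    using that by (auto simp: pvecs_zero intro!: pvecs_eq)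
qed

text \<open>All pairs (P, g) over S form a finite set, on which \<open>rel\<close> acts inside each
  component; this is the setting of \<open>reproducing_family\<close>. The expansion is along the
  first factor, hence the finiteness of S.\<close>

lemma tensor_pvecs_iff:
  assumes "finite S"
  shows "t \<in> pvecs S \<otimes>\<^sub>s pvecs T \<longleftrightarrow>
    (\<forall>y. (\<lambda>x. t (x, y)) \<in> pvecs S) \<and> (\<forall>x. (\<lambda>y. t (x, y)) \<in> pvecs T)"
proof -
  define X where "X = Sigma (posets S) (pattern_group S :: 'a rel \<Rightarrow> ('a, 'k) mtx set)"
  define R where "R = {((P, g), (P, h)) | P g h. P \<in> posets S \<and>
    g \<in> pattern_group S P \<and> h \<in> pattern_group S P \<and> rel S P g h}"
  have fin: "finite X"
    unfolding X_def using assms by (intro finite_SigmaI finite_posets finite_pattern_group)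
  have R: "R \<subseteq> X \<times> X" by (auto simp: R_def X_def)
  have eq: "{v. (\<forall>x. x \<notin> X \<longrightarrow> v x = 0) \<and> (\<forall>(x, y)\<in>R. v x = v y)} = pvecs S"
    unfolding pvecs_iff set_eq_iff mem_Collect_eq by (auto simp: X_def R_def)
  show ?thesis
  proof (rule reproducing_family[OF fin R, unfolded eq])
    fix e assume e: "\<And>x. x \<in> X \<Longrightarrow> e x \<in> pvecs S"
      "\<And>v y. v \<in> pvecs S \<Longrightarrow> v y = (\<Sum>x\<in>X. v x * e x y)"
    show ?thesis by (rule tensor_iff_slices[OF pvecs_subspace pvecs_subspace fin e])
  qed
qed

section \<open>Closure of the invariant vectors under action, product and coproduct\<close>

lemma fp_act_pvecs:
  assumes "finite I" "inj_on \<sigma> I" and v: "v \<in> pvecs I"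
  shows "fp_act I \<sigma> v \<in> pvecs (\<sigma> ` I)"
  unfolding pvecs_iff
proof (intro conjI allI ballI impI)
  fix P and g h :: "('a, 'k) mtx"
  assume "P \<in> posets (\<sigma> ` I)" "g \<in> pattern_group (\<sigma> ` I) P" "h \<in> pattern_group (\<sigma> ` I) P"
    "rel (\<sigma> ` I) P g h"
  thus "fp_act I \<sigma> v (P, g) = fp_act I \<sigma> v (P, h)"
    using assms by (auto simp: fp_act_apply
        intro!: pvecs_eq[OF v] pullback_posets relabel_pattern_group rel_relabel)
qed (use assms in \<open>auto simp: fp_act_apply\<close>)

lemma fp_mult_pvecs:
  assumes fin: "finite S" "finite T" and disj: "S \<inter> T = {}" and t: "t \<in> pvecs S \<otimes>\<^sub>s pvecs T"
  shows "fp_mult S T t \<in> pvecs (S \<union> T)"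
  unfolding pvecs_iff
proof (intro conjI allI ballI impI)
  fix R and g h :: "('a, 'k) mtx"
  assume R: "R \<in> posets (S \<union> T)" and gh: "g \<in> pattern_group (S \<union> T) R"
    "h \<in> pattern_group (S \<union> T) R" "rel (S \<union> T) R g h"
  show "fp_mult S T t (R, g) = fp_mult S T t (R, h)"
  proof (cases "S \<times> T \<subseteq> R")
    case True
    \<comment> \<open>Hence S is a down-set and T an up-set of R, and both are order-convex as
      \<open>rel_block\<close> demands.\<close>
    have down: "(j, i) \<notin> R" if "i \<in> S" "j \<in> T" for i j
      using that True disj posets_antisym[OF R, of i j] by blast
    have "k \<in> S" if "i \<in> S" "j \<in> S" "(i, k) \<in> R" "(k, j) \<in> R" for i j k
      using that down posets_dom[OF R] by blast
    note relS = rel_block[OF finite_UnI[OF fin] R Un_upper1 this gh]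
    have "k \<in> T" if "i \<in> T" "j \<in> T" "(i, k) \<in> R" "(k, j) \<in> R" for i j k
      using that down posets_dom[OF R] by blast
    note relT = rel_block[OF finite_UnI[OF fin] R Un_upper2 this gh]
    note mem = Restr_posets[OF R] block_pattern_group[OF gh(1)] block_pattern_group[OF gh(2)]
    \<comment> \<open>The blocks are exchanged one at a time, since invariance of a tensor is
      available for its slices.\<close>
    have "t ((Restr R S, block S g), (Restr R T, block T g)) =
          t ((Restr R S, block S h), (Restr R T, block T g))"
      using t relS mem pvecs_eq[of "\<lambda>x. t (x, (Restr R T, block T g))" S]
      by (auto simp: tensor_pvecs_iff[OF fin(1)])
    also have "\<dots> = t ((Restr R S, block S h), (Restr R T, block T h))"
      using t relT mem pvecs_eq[of "\<lambda>y. t ((Restr R S, block S h), y)" T]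
      by (auto simp: tensor_pvecs_iff[OF fin(1)])
    finally show ?thesis using fin disj R gh by (simp add: fp_mult_apply)
  qed (use fin disj in \<open>simp add: fp_mult_apply\<close>)
qed (use fin disj in \<open>auto simp: fp_mult_apply\<close>)

lemma fp_comult_pvecs:
  assumes fin: "finite S" "finite T" and disj: "S \<inter> T = {}" and v: "v \<in> pvecs (S \<union> T)"
  shows "fp_comult S T v \<in> pvecs S \<otimes>\<^sub>s pvecs T"
  unfolding tensor_pvecs_iff[OF fin(1)] pvecs_iff split_paired_All
proof (intro conjI allI ballI impI)
  fix P Q and g h :: "('a, 'k) mtx"
  show "fp_comult S T v ((P, g), (Q, h)) = 0" if "\<not> (P \<in> posets S \<and> g \<in> pattern_group S P)"
    using that glueings_posets(2)[of _ S T P Q]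
    by (auto simp: fp_comult_apply fin intro!: sum.neutral)
  show "fp_comult S T v ((P, g), (Q, h)) = 0" if "\<not> (Q \<in> posets T \<and> h \<in> pattern_group T Q)"
    using that glueings_posets(3)[of _ S T P Q]
    by (auto simp: fp_comult_apply fin intro!: sum.neutral)
next
  fix Q P and g g' h :: "('a, 'k) mtx"
  assume g: "g \<in> pattern_group S P" "g' \<in> pattern_group S P" and rel: "rel S P g g'"
  \<comment> \<open>Invariance already holds for each glueing R separately, both block sums lying in
    the group of the same R.\<close>
  have "v (R, block_sum S T g h) = v (R, block_sum S T g' h)"
    if R: "R \<in> glueings S T P Q" and h: "h \<in> pattern_group T Q" for R
    using glueings_posets[OF R] g h rel fin disj
    by (intro pvecs_eq[OF v] block_sum_pattern_group rel_block_sum) auto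
  thus "fp_comult S T v ((P, g), (Q, h)) = fp_comult S T v ((P, g'), (Q, h))"
    using g by (auto simp: fp_comult_apply fin intro!: sum.cong)
next
  fix P Q and g h h' :: "('a, 'k) mtx"
  assume h: "h \<in> pattern_group T Q" "h' \<in> pattern_group T Q" and rel: "rel T Q h h'"
  have "v (R, block_sum S T g h) = v (R, block_sum S T g h')"
    if R: "R \<in> glueings S T P Q" and g: "g \<in> pattern_group S P" for R
  proof -
    \<comment> \<open>\<open>rel_block_sum\<close> varies the first block, so the roles of S and T
      are exchanged here and restored by \<open>block_sum_commute\<close>.\<close>
    have "rel (T \<union> S) R (block_sum T S h g) (block_sum T S h' g)"
      using glueings_posets[OF R] g h rel fin disj by (intro rel_block_sum) (auto simp: Un_commute)
    thus ?thesis
      using glueings_posets[OF R] g h disj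
      by (intro pvecs_eq[OF v] block_sum_pattern_group)
        (auto simp: Un_commute block_sum_commute[of S T])
  qed
  thus "fp_comult S T v ((P, g), (Q, h)) = fp_comult S T v ((P, g), (Q, h'))"
    using h by (auto simp: fp_comult_apply fin intro!: sum.cong)
qed

section \<open>The unit and the Hopf monoid of invariant vectors\<close>

lemma fp_unit_apply: "fp_unit (P, g) = (if P = {} \<and> g = (\<lambda>_ _. 0) then 1 else 0)"
  by (auto simp: fp_unit_def incl_def restrict0_def pattern_group_empty)

lemma glueings_empty:
  "glueings S {} P Q = (if P \<in> posets S \<and> Q = {} then {P} else {})"
  "glueings {} S P Q = (if Q \<in> posets S \<and> P = {} then {Q} else {})"
  by (auto simp: glueings_def Restr_eq_self dest: posets_dom)

lemma hopf_monoid_pvecs: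
  "hopf_monoid pvecs fp_act (fp_unit :: ('a, 'k) pvec) fp_mult fp_comult"
proof unfold_locales
  show "cfun.subspace (pvecs I)" for I by (rule pvecs_subspace)
  show "lin_map (pvecs I) (pvecs (\<sigma> ` I)) (fp_act I \<sigma>)" if "finite I" "inj_on \<sigma> I" for I \<sigma>
    using that by (auto simp: lin_map_def fp_act_pvecs fun_eq_iff fp_act_apply cscale_def)
  show "fp_act I \<sigma> x = fp_act I \<tau> x"
    if "finite I" "inj_on \<sigma> I" "\<And>i. i \<in> I \<Longrightarrow> \<sigma> i = \<tau> i" for I \<sigma> \<tau> and x :: "('a, 'k) pvec"
    using that by (rule fp_act_cong)
  show "fp_act I id x = x" if "finite I" "x \<in> pvecs I" for I x
  proof (intro ext, clarify)
    fix P and g :: "('a, 'k) mtx"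
    have "pullback I id P = P" if "P \<in> posets I"
      using posets_subset[OF that] by (auto simp: pullback_def)
    moreover have "relabel_mtx I id g = block I g"
      by (auto simp: relabel_mtx_def block_def fun_eq_iff)
    ultimately show "fp_act I id x (P, g) = x (P, g)"
      using that pvecs_zero[of x I P g] block_self[of g I P] by (auto simp: fp_act_apply)
  qed
  show "fp_act I (\<tau> \<circ> \<sigma>) x = fp_act (\<sigma> ` I) \<tau> (fp_act I \<sigma> x)"
    if "finite I" "inj_on \<sigma> I" "inj_on \<tau> (\<sigma> ` I)" for I \<sigma> \<tau> and x :: "('a, 'k) pvec"
    using that by (rule fp_act_comp)
  show "(fp_unit :: ('a, 'k) pvec) \<noteq> 0"
    by (auto simp: fun_eq_iff fp_unit_apply)
  show "pvecs {} = cfun.span {fp_unit}"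
  proof (intro equalityI subsetI)
    fix v assume v: "v \<in> pvecs {}"
    \<comment> \<open>Over the empty set there is one poset with one matrix, so v is determined by a
      single value.\<close>
    have "v (P, g) = cscale (v ({}, \<lambda>_ _. 0)) fp_unit (P, g)" for P g
      using pvecs_zero[OF v, of P g]
      by (auto simp: cscale_def fp_unit_apply posets_empty pattern_group_empty)
    hence "v = cscale (v ({}, \<lambda>_ _. 0)) fp_unit"
      by (intro ext) (metis prod.collapse)
    thus "v \<in> cfun.span {fp_unit}"
      by (metis cfun.span_base cfun.span_scale singletonI)
  next
    have "fp_unit \<in> pvecs {}"
      unfolding pvecs_iff by (auto simp: fp_unit_apply posets_empty pattern_group_empty)
    thus "v \<in> pvecs {}" if "v \<in> cfun.span {fp_unit}" for v
      using that cfun.span_minimal[of "{fp_unit}" "pvecs {}"] pvecs_subspace by blast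
  qed
  show "lin_map (pvecs S \<otimes>\<^sub>s pvecs T) (pvecs (S \<union> T)) (fp_mult S T)"
    if "finite S" "finite T" "S \<inter> T = {}" for S T
    using that by (auto simp: lin_map_def fp_mult_pvecs fun_eq_iff fp_mult_apply cscale_def)
  show "lin_map (pvecs (S \<union> T)) (pvecs S \<otimes>\<^sub>s pvecs T) (fp_comult S T)"
    if "finite S" "finite T" "S \<inter> T = {}" for S T
    using that by (auto simp: lin_map_def fp_comult_pvecs fun_eq_iff fp_comult_apply cscale_def
        sum.distrib sum_distrib_left)
  show "fp_act (S \<union> T) (union_map S \<sigma> \<tau>) (fp_mult S T t) =
      fp_mult S' T' ((fp_act S \<sigma> \<otimes>\<^sub>m fp_act T \<tau>) t)"
    if "finite S" "finite T" "S \<inter> T = {}" "S' \<inter> T' = {}" "bij_betw \<sigma> S S'" "bij_betw \<tau> T T'"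
    for S T S' T' \<sigma> \<tau> and t :: "('a rel \<times> ('a, 'k) mtx) \<times> ('a rel \<times> ('a, 'k) mtx) \<Rightarrow> complex"
    using that by (rule fp_mult_natural)
  show "(fp_act S \<sigma> \<otimes>\<^sub>m fp_act T \<tau>) (fp_comult S T x) =
      fp_comult S' T' (fp_act (S \<union> T) (union_map S \<sigma> \<tau>) x)"
    if "finite S" "finite T" "S \<inter> T = {}" "S' \<inter> T' = {}" "bij_betw \<sigma> S S'" "bij_betw \<tau> T T'"
    for S T S' T' \<sigma> \<tau> and x :: "('a, 'k) pvec"
    using that by (rule fp_comult_natural)
  show "fp_mult (R \<union> S) T ((fp_mult R S \<otimes>\<^sub>m id) w) =
      fp_mult R (S \<union> T) ((id \<otimes>\<^sub>m fp_mult S T) (tensor_assoc w))"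
    if "finite R" "finite S" "finite T" "R \<inter> S = {}" "R \<inter> T = {}" "S \<inter> T = {}"
    for R S T and w :: "(('a rel \<times> ('a, 'k) mtx) \<times> 'a rel \<times> ('a, 'k) mtx) \<times>
      'a rel \<times> ('a, 'k) mtx \<Rightarrow> complex"
    using that by (rule fp_mult_assoc)
  show "tensor_assoc ((fp_comult R S \<otimes>\<^sub>m id) (fp_comult (R \<union> S) T x)) =
      (id \<otimes>\<^sub>m fp_comult S T) (fp_comult R (S \<union> T) x)"
    if "finite R" "finite S" "finite T" "R \<inter> S = {}" "R \<inter> T = {}" "S \<inter> T = {}"
    for R S T and x :: "('a, 'k) pvec"
    using that by (rule fp_comult_coassoc)
  show "fp_comult T\<^sub>1 T\<^sub>2 (fp_mult S\<^sub>1 S\<^sub>2 t) =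
      (fp_mult A C \<otimes>\<^sub>m fp_mult B D) (tensor_swap ((fp_comult A B \<otimes>\<^sub>m fp_comult C D) t))"
    if "finite I" "S\<^sub>1 \<union> S\<^sub>2 = I" "S\<^sub>1 \<inter> S\<^sub>2 = {}" "T\<^sub>1 \<union> T\<^sub>2 = I" "T\<^sub>1 \<inter> T\<^sub>2 = {}"
      "A = S\<^sub>1 \<inter> T\<^sub>1" "B = S\<^sub>1 \<inter> T\<^sub>2" "C = S\<^sub>2 \<inter> T\<^sub>1" "D = S\<^sub>2 \<inter> T\<^sub>2"
    for I S\<^sub>1 S\<^sub>2 T\<^sub>1 T\<^sub>2 A B C D
      and t :: "('a rel \<times> ('a, 'k) mtx) \<times> ('a rel \<times> ('a, 'k) mtx) \<Rightarrow> complex"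
    using that by (intro fp_compatible) auto
next
  fix S :: "'a set" and x
  assume S: "finite S" and x: "x \<in> pvecs S"
  have empty: "(\<lambda>_ _. 0) \<in> pattern_group {} {}" "block {} g = (\<lambda>_ _. 0)" for g :: "('a, 'k) mtx"
    by (auto simp: pattern_group_empty block_def)
  show "fp_mult S {} (x \<otimes>\<^sub>v fp_unit) = x" "fp_mult {} S (fp_unit \<otimes>\<^sub>v x) = x"
    using S pvecs_zero[OF x]
    by (auto simp: fun_eq_iff[of _ x] fp_mult_apply pure_tensor_def fp_unit_apply empty
        Restr_eq_self block_self)
  have "block_sum S {} g h = block S g" "block_sum {} S h g = block S g" for g h :: "('a, 'k) mtx"
    by (auto simp: block_sum_def block_def fun_eq_iff)
  thus "fp_comult S {} x = x \<otimes>\<^sub>v fp_unit" "fp_comult {} S x = fp_unit \<otimes>\<^sub>v x"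
    using S pvecs_zero[OF x]
    by (auto simp: fun_eq_iff[of _ "_ \<otimes>\<^sub>v _"] fp_comult_apply pure_tensor_def fp_unit_apply
        glueings_empty block_self pattern_group_empty)
qed

end


section \<open>Nonnesting superclasses\<close>

text \<open>The minimality clause of \<open>sml\<close>, detached from the entry at (i, j) so that
  it can also be compared at positions where that entry is zero.\<close>

definition inner_zero :: "'a rel \<Rightarrow> ('a, 'k::zero) mtx \<Rightarrow> 'a \<Rightarrow> 'a \<Rightarrow> bool" where
  "inner_zero P g i j \<longleftrightarrow>
     (\<forall>k l. (k, l) \<noteq> (i, j) \<and> (i, k) \<in> P \<and> prec P k l \<and> (l, j) \<in> P \<longrightarrow> g k l = 0)"

lemma inner_zeroD:
  "\<lbrakk>inner_zero P g i j; (k, l) \<noteq> (i, j); (i, k) \<in> P; prec P k l; (l, j) \<in> P\<rbrakk> \<Longrightarrow> g k l = 0"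
  unfolding inner_zero_def by blast

lemma sml_iff:
  "(i, c, j) \<in> sml P g \<longleftrightarrow> prec P i j \<and> c = g i j \<and> g i j \<noteq> 0 \<and> inner_zero P g i j"
  unfolding sml_def inner_zero_def by blast

lemma sml_eqI: "(\<And>i c j. (i, c, j) \<in> sml P g \<longleftrightarrow> (i, c, j) \<in> sml P h) \<Longrightarrow> sml P g = sml P h"
  by (simp add: set_eq_iff split_paired_All)

text \<open>The smaller interval misses the corner (i, j), the one position in the larger interval
  where \<open>g\<close> is unrestricted: otherwise antisymmetry would identify the two
  intervals.\<close>

lemma inner_zero_subinterval:
  assumes P: "P \<in> posets I" and zero: "inner_zero P g i j"
    and kl: "(k, l) \<noteq> (i, j)" "(i, k) \<in> P" "(k, l) \<in> P" "(l, j) \<in> P"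
  shows "inner_zero P g k l"
  unfolding inner_zero_def
proof (intro allI impI, elim conjE)
  fix k' l' assume *: "(k, k') \<in> P" "prec P k' l'" "(l', l) \<in> P"
  have "(k', l') \<noteq> (i, j)"
    using * kl posets_antisym[OF P] by blast
  thus "g k' l' = 0"
    using * kl posets_trans[OF P] by (intro inner_zeroD[OF zero]) blast+
qed

text \<open>As long as the entry is not minimal, its interval contains another nonzero entry, whose
  interval has fewer elements; by finiteness this descent stops at an arc.\<close>

lemma sml_exists:
  assumes "finite I" "P \<in> posets I" "prec P i j" "g i j \<noteq> 0"
  obtains k l where "(i, k) \<in> P" "(l, j) \<in> P" "(k, g k l, l) \<in> sml P g"
proof -
  note P = assms(2)
  define N where "N = (\<lambda>(i, j). {m. (i, m) \<in> P \<and> (m, j) \<in> P})"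
  have fin: "finite (N x)" for x
    using posets_dom[OF P] by (intro finite_subset[OF _ assms(1)]) (auto simp: N_def)
  have "\<exists>k l. (i, k) \<in> P \<and> (l, j) \<in> P \<and> (k, g k l, l) \<in> sml P g"
    using assms(3,4)
  proof (induction "card (N (i, j))" arbitrary: i j rule: less_induct)
    case less
    have ij: "(i, j) \<in> P" using less.prems by (simp add: prec_def)
    note refl = posets_refl[OF P posets_dom(1)[OF P ij]] posets_refl[OF P posets_dom(2)[OF P ij]]
    show ?case
    proof (cases "inner_zero P g i j")
      case True
      thus ?thesis using less.prems refl by (auto simp: sml_iff)
    next
      case False
      then obtain k l where kl: "(k, l) \<noteq> (i, j)" "(i, k) \<in> P" "prec P k l" "(l, j) \<in> P" "g k l \<noteq> 0"
        unfolding inner_zero_def by blast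
      have sub: "N (k, l) \<subseteq> N (i, j)"
        using kl posets_trans[OF P] unfolding N_def by blast
      \<comment> \<open>If the smaller interval kept both i and j, antisymmetry would give k = i and
        l = j. An endpoint is lost, so the cardinality drops.\<close>
      moreover have "i \<notin> N (k, l) \<or> j \<notin> N (k, l)"
        using kl posets_antisym[OF P] unfolding N_def by blast
      moreover have "i \<in> N (i, j)" "j \<in> N (i, j)" using refl ij by (auto simp: N_def)
      ultimately have "N (k, l) \<subset> N (i, j)" by blast
      from less.hyps[OF psubset_card_mono[OF fin this] kl(3,5)]
      show ?thesis using kl(2,4) posets_trans[OF P] by blast
    qed
  qed
  thus ?thesis using that by blast
qed

section \<open>Minimal arcs under relabelling, convex blocks and block sums\<close>

lemma sml_relabel:
  assumes "P \<in> posets (\<sigma> ` I)" "inj_on \<sigma> I"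
  shows "(i, c, j) \<in> sml (pullback I \<sigma> P) (relabel_mtx I \<sigma> g) \<longleftrightarrow>
    i \<in> I \<and> j \<in> I \<and> (\<sigma> i, c, \<sigma> j) \<in> sml P g"
proof -
  have eq: "\<sigma> k = \<sigma> l \<longleftrightarrow> k = l" if "k \<in> I" "l \<in> I" for k l
    using assms(2) that by (auto simp: inj_on_def)
  have prec: "prec (pullback I \<sigma> P) k l \<longleftrightarrow> k \<in> I \<and> l \<in> I \<and> prec P (\<sigma> k) (\<sigma> l)" for k l
    using eq by (auto simp: prec_def pullback_def)
  have "inner_zero (pullback I \<sigma> P) (relabel_mtx I \<sigma> g) i j \<longleftrightarrow> inner_zero P g (\<sigma> i) (\<sigma> j)"
    if "i \<in> I" "j \<in> I"
  proof -
    have "inner_zero (pullback I \<sigma> P) (relabel_mtx I \<sigma> g) i j \<longleftrightarrow>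
        (\<forall>k\<in>I. \<forall>l\<in>I. (\<sigma> k, \<sigma> l) \<noteq> (\<sigma> i, \<sigma> j) \<and> (\<sigma> i, \<sigma> k) \<in> P \<and> prec P (\<sigma> k) (\<sigma> l) \<and>
          (\<sigma> l, \<sigma> j) \<in> P \<longrightarrow> g (\<sigma> k) (\<sigma> l) = 0)"
      unfolding inner_zero_def prec using that
      by (auto simp: pullback_def relabel_mtx_def eq)
    also have "\<dots> \<longleftrightarrow> (\<forall>k\<in>\<sigma> ` I. \<forall>l\<in>\<sigma> ` I. (k, l) \<noteq> (\<sigma> i, \<sigma> j) \<and> (\<sigma> i, k) \<in> P \<and> prec P k l \<and>
          (l, \<sigma> j) \<in> P \<longrightarrow> g k l = 0)"
      by simp
    also have "\<dots> \<longleftrightarrow> inner_zero P g (\<sigma> i) (\<sigma> j)"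
    proof -
      have "k \<in> \<sigma> ` I \<and> l \<in> \<sigma> ` I" if "prec P k l" for k l
        using that posets_dom[OF assms(1), of k l] by (simp add: prec_def)
      thus ?thesis unfolding inner_zero_def by meson
    qed
    finally show ?thesis .
  qed
  thus ?thesis
    unfolding sml_iff prec by (auto simp: relabel_mtx_def)
qed

text \<open>For i and j in C, convexity places every entry that can obstruct minimality inside the
  block, so the test gives the same answer there.\<close>

lemma sml_block:
  assumes P: "P \<in> posets I"
    and convex: "\<And>i j k. i \<in> C \<Longrightarrow> j \<in> C \<Longrightarrow> (i, k) \<in> P \<Longrightarrow> (k, j) \<in> P \<Longrightarrow> k \<in> C"
  shows "(i, c, j) \<in> sml (Restr P C) (block C g) \<longleftrightarrow> i \<in> C \<and> j \<in> C \<and> (i, c, j) \<in> sml P g"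
proof -
  have prec: "prec (Restr P C) k l \<longleftrightarrow> k \<in> C \<and> l \<in> C \<and> prec P k l" for k l
    by (auto simp: prec_def)
  have "inner_zero (Restr P C) (block C g) i j \<longleftrightarrow> inner_zero P g i j" if ij: "i \<in> C" "j \<in> C"
  proof -
    have "k \<in> C \<and> l \<in> C" if "(i, k) \<in> P" "prec P k l" "(l, j) \<in> P" for k l
      using that convex[OF ij, of k] convex[OF ij, of l] posets_trans[OF P]
      unfolding prec_def by blast
    thus ?thesis
      using ij unfolding inner_zero_def prec block_def by (auto; blast)
  qed
  thus ?thesis
    unfolding sml_iff prec by (auto simp: block_def)
qed

text \<open>
  An arc of \<open>T\<close> survives in the block sum iff no nonzero entry of \<open>g\<close> lies inside it; by
  \<open>sml_exists\<close> this can be read off from the smallest such entries, that is, from \<open>sml\<close> of \<open>g\<close>.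
\<close>

lemma sml_block_sum_mono:
  assumes fin: "finite S" and disj: "S \<inter> T = {}" and R: "R \<in> posets (S \<union> T)"
    and eq: "sml (Restr R S) g = sml (Restr R S) g'"
    and arc: "(i, c, j) \<in> sml R (block_sum S T g h)"
  shows "(i, c, j) \<in> sml R (block_sum S T g' h)"
proof -
  define x where "x = block_sum S T g h"
  define x' where "x' = block_sum S T g' h"
  have xS: "x k l = g k l" "x' k l = g' k l" if "k \<in> S" "l \<in> S" for k l
    using that by (simp_all add: x_def x'_def block_sum_def)
  have xT: "x k l = h k l" "x' k l = h k l" if "k \<in> T" "l \<in> T" for k l
    using that disj by (auto simp: x_def x'_def block_sum_def)
  have cases: "k \<in> S \<and> l \<in> S \<or> k \<in> T \<and> l \<in> T" if "x k l \<noteq> 0 \<or> x' k l \<noteq> 0" for k l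
    using that by (auto simp: x_def x'_def block_sum_def split: if_splits)
  have RS: "Restr R S \<in> posets S" using R by (rule Restr_posets) auto
  have ij: "prec R i j" "c = x i j" "x i j \<noteq> 0" and zero: "inner_zero R x i j"
    using arc by (auto simp: sml_iff x_def)
  consider (S) "i \<in> S" "j \<in> S" | (T) "i \<in> T" "j \<in> T" using cases ij(3) by blast
  thus ?thesis
  proof cases
    case S
    \<comment> \<open>An arc inside S stays minimal among the entries of \<open>g\<close>, so it is
      an arc of \<open>g\<close> and through \<open>eq\<close> one of \<open>g'\<close>. Entries of
      T inside it come from the common \<open>h\<close>.\<close>
    have "inner_zero (Restr R S) g i j"
      unfolding inner_zero_def
    proof (intro allI impI, elim conjE)
      fix k l assume "(k, l) \<noteq> (i, j)" "(i, k) \<in> Restr R S" "prec (Restr R S) k l" "(l, j) \<in> Restr R S"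
      thus "g k l = 0" using inner_zeroD[OF zero, of k l] xS(1)[of k l] by (auto simp: prec_def)
    qed
    hence "(i, c, j) \<in> sml (Restr R S) g"
      using ij S by (auto simp: sml_iff prec_def xS)
    hence g': "c = g' i j" and zero': "inner_zero (Restr R S) g' i j"
      unfolding eq sml_iff by auto
    have "inner_zero R x' i j"
      unfolding inner_zero_def
    proof (intro allI impI, elim conjE, rule ccontr)
      fix k l assume kl: "(k, l) \<noteq> (i, j)" "(i, k) \<in> R" "prec R k l" "(l, j) \<in> R" and nz: "x' k l \<noteq> 0"
      from nz have "k \<in> S \<and> l \<in> S \<or> k \<in> T \<and> l \<in> T" using cases by blast
      thus False
      proof (elim disjE conjE)
        assume "k \<in> S" "l \<in> S"
        thus False using inner_zeroD[OF zero' kl(1)] kl S nz xS(2) by (auto simp: prec_def)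
      next
        assume "k \<in> T" "l \<in> T"
        thus False using inner_zeroD[OF zero kl] nz xT by auto
      qed
    qed
    thus ?thesis
      using ij S g' unfolding x'_def[symmetric] sml_iff by (simp add: xS)
  next
    case T
    have "inner_zero R x' i j"
      unfolding inner_zero_def
    proof (intro allI impI, elim conjE, rule ccontr)
      fix k l assume kl: "(k, l) \<noteq> (i, j)" "(i, k) \<in> R" "prec R k l" "(l, j) \<in> R" and nz: "x' k l \<noteq> 0"
      from nz have "k \<in> S \<and> l \<in> S \<or> k \<in> T \<and> l \<in> T" using cases by blast
      thus False
      proof (elim disjE conjE)
        assume "k \<in> S" "l \<in> S"
        hence "prec (Restr R S) k l" "g' k l \<noteq> 0" using kl nz xS by (auto simp: prec_def)
        then obtain k' l' where *: "(k, k') \<in> Restr R S" "(l', l) \<in> Restr R S"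
          "(k', g' k' l', l') \<in> sml (Restr R S) g'"
          by (rule sml_exists[OF fin RS])
        \<comment> \<open>Through \<open>eq\<close> this arc belongs to \<open>g\<close> as well, so
          the original block sum has a nonzero entry inside the interval from i to j, against
          \<open>zero\<close>.\<close>
        hence "(k', g' k' l', l') \<in> sml (Restr R S) g" using eq by simp
        hence "prec R k' l'" "g k' l' \<noteq> 0" by (auto simp: sml_iff prec_def)
        moreover have "(i, k') \<in> R" "(l', j) \<in> R" "(k', l') \<noteq> (i, j)"
          using * kl T disj posets_trans[OF R] by blast+
        ultimately show False
          using inner_zeroD[OF zero, of k' l'] xS(1)[of k' l'] * by auto
      next
        assume "k \<in> T" "l \<in> T"
        thus False using inner_zeroD[OF zero kl] nz xT by auto
      qed
    qed
    thus ?thesis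
      using ij T unfolding x'_def[symmetric] sml_iff by (simp add: xT)
  qed
qed

lemma sml_pattern_relation:
  "pattern_relation (\<lambda>_ P g h. sml P g = sml P (h :: ('a, 'k::{field,finite}) mtx))"
proof
  fix I P and \<sigma> :: "'a \<Rightarrow> 'a" and g h :: "('a, 'k) mtx"
  assume "inj_on \<sigma> I" "P \<in> posets (\<sigma> ` I)" "sml P g = sml P h"
  thus "sml (pullback I \<sigma> P) (relabel_mtx I \<sigma> g) = sml (pullback I \<sigma> P) (relabel_mtx I \<sigma> h)"
    by (intro sml_eqI) (simp add: sml_relabel)
next
  fix I C and P :: "'a rel" and g h :: "('a, 'k) mtx"
  assume P: "P \<in> posets I"
    and convex: "\<And>i j k. i \<in> C \<Longrightarrow> j \<in> C \<Longrightarrow> (i, k) \<in> P \<Longrightarrow> (k, j) \<in> P \<Longrightarrow> k \<in> C"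
    and eq: "sml P g = sml P h"
  have "(i, c, j) \<in> sml (Restr P C) (block C x) \<longleftrightarrow> i \<in> C \<and> j \<in> C \<and> (i, c, j) \<in> sml P x"
    for i j c and x :: "('a, 'k) mtx"
    using P convex by (rule sml_block)
  thus "sml (Restr P C) (block C g) = sml (Restr P C) (block C h)"
    by (intro sml_eqI) (simp only: eq)
next
  fix S T and R :: "'a rel" and g g' h :: "('a, 'k) mtx"
  assume "finite S" "S \<inter> T = {}" "R \<in> posets (S \<union> T)" "sml (Restr R S) g = sml (Restr R S) g'"
  \<comment> \<open>The hypotheses are symmetric in \<open>g\<close> and \<open>g'\<close>, so
    \<open>sml_block_sum_mono\<close> gives both inclusions.\<close>
  thus "sml R (block_sum S T g h) = sml R (block_sum S T g' h)"
    by (intro sml_eqI iffI; elim sml_block_sum_mono[rotated -1]) auto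
qed


section \<open>Algebra group superclasses\<close>

text \<open>As one sum over the middle entries, the product shows which of them reach position (i,
  j); blocks and entries are then compared by discarding vanishing terms.\<close>

lemma mtx_mult_triple:
  assumes "finite I"
  shows "mtx_mult I (mtx_mult I a x) b i j = (\<Sum>(k, l)\<in>I \<times> I. a i k * x k l * b l j)"
proof -
  have "mtx_mult I (mtx_mult I a x) b i j = (\<Sum>l\<in>I. \<Sum>k\<in>I. a i k * x k l * b l j)"
    by (simp add: mtx_mult_def sum_distrib_right)
  also have "\<dots> = (\<Sum>(k, l)\<in>I \<times> I. a i k * x k l * b l j)"
    by (subst sum.swap) (simp add: sum.cartesian_product)
  finally show ?thesis .
qed

lemma superclass_iff:
  assumes "finite I"
  shows "h \<in> superclass I P g \<longleftrightarrow> h \<in> pattern_group I P \<and>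
    (\<exists>a\<in>pattern_group I P. \<exists>b\<in>pattern_group I P. \<forall>i j. h i j - mtx_one I i j =
      (\<Sum>(k, l)\<in>I \<times> I. a i k * (g k l - mtx_one I k l) * b l j))"
  unfolding superclass_def by (simp add: fun_eq_iff mtx_mult_triple[OF assms])

section \<open>Superclasses under relabelling, convex blocks and block sums\<close>

lemma superclass_relabel:
  assumes fin: "finite I" and inj: "inj_on \<sigma> I" and h: "h \<in> superclass (\<sigma> ` I) P g"
  shows "relabel_mtx I \<sigma> h \<in> superclass I (pullback I \<sigma> P) (relabel_mtx I \<sigma> g)"
proof -
  obtain a b where ab: "a \<in> pattern_group (\<sigma> ` I) P" "b \<in> pattern_group (\<sigma> ` I) P"
    and eq: "\<And>i j. h i j - mtx_one (\<sigma> ` I) i j =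
      (\<Sum>(k, l)\<in>\<sigma> ` I \<times> \<sigma> ` I. a i k * (g k l - mtx_one (\<sigma> ` I) k l) * b l j)"
    using h fin by (auto simp: superclass_iff)
  have one: "mtx_one (\<sigma> ` I) (\<sigma> k) (\<sigma> l) = mtx_one I k l" if "k \<in> I" "l \<in> I" for k l
    using that inj by (auto simp: mtx_one_def inj_on_def)
  have "relabel_mtx I \<sigma> h i j - mtx_one I i j =
      (\<Sum>(k, l)\<in>I \<times> I. relabel_mtx I \<sigma> a i k * (relabel_mtx I \<sigma> g k l - mtx_one I k l) *
        relabel_mtx I \<sigma> b l j)" for i j
  proof (cases "i \<in> I \<and> j \<in> I")
    case True
    have "relabel_mtx I \<sigma> h i j - mtx_one I i j = h (\<sigma> i) (\<sigma> j) - mtx_one (\<sigma> ` I) (\<sigma> i) (\<sigma> j)"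
      using True by (simp add: relabel_mtx_def one)
    also have "\<dots> = (\<Sum>(k, l)\<in>map_prod \<sigma> \<sigma> ` (I \<times> I).
        a (\<sigma> i) k * (g k l - mtx_one (\<sigma> ` I) k l) * b l (\<sigma> j))"
      unfolding eq by (rule sum.cong) auto
    also have "\<dots> = (\<Sum>(k, l)\<in>I \<times> I.
        a (\<sigma> i) (\<sigma> k) * (g (\<sigma> k) (\<sigma> l) - mtx_one (\<sigma> ` I) (\<sigma> k) (\<sigma> l)) * b (\<sigma> l) (\<sigma> j))"
      using map_prod_inj_on[OF inj inj] by (simp add: sum.reindex case_prod_unfold)
    also have "\<dots> = (\<Sum>(k, l)\<in>I \<times> I. relabel_mtx I \<sigma> a i k *
        (relabel_mtx I \<sigma> g k l - mtx_one I k l) * relabel_mtx I \<sigma> b l j)"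
      using True by (intro sum.cong) (auto simp: relabel_mtx_def one)
    finally show ?thesis .
  next
    case False
    thus ?thesis by (auto simp: relabel_mtx_def mtx_one_def intro!: sum.neutral[symmetric])
  qed
  moreover have "relabel_mtx I \<sigma> h \<in> pattern_group I (pullback I \<sigma> P)"
    "relabel_mtx I \<sigma> a \<in> pattern_group I (pullback I \<sigma> P)"
    "relabel_mtx I \<sigma> b \<in> pattern_group I (pullback I \<sigma> P)"
    using h ab inj by (auto simp: superclass_def intro: relabel_pattern_group)
  ultimately show ?thesis
    unfolding superclass_iff[OF fin] by blast
qed

text \<open>A nonzero term (k, l) at position (i, j) requires i \<preceq> k \<prec> l \<preceq> j.
  For i and j in C convexity puts k and l in C, so the sum involves only the blocks of the three
  factors.\<close>

lemma superclass_block: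
  assumes fin: "finite I" and P: "P \<in> posets I" and C: "C \<subseteq> I"
    and convex: "\<And>i j k. i \<in> C \<Longrightarrow> j \<in> C \<Longrightarrow> (i, k) \<in> P \<Longrightarrow> (k, j) \<in> P \<Longrightarrow> k \<in> C"
    and g: "g \<in> pattern_group I P" and h: "h \<in> superclass I P g"
  shows "block C h \<in> superclass C (Restr P C) (block C g)"
proof -
  have finC: "finite C" using C fin by (rule finite_subset)
  obtain a b where ab: "a \<in> pattern_group I P" "b \<in> pattern_group I P"
    and eq: "\<And>i j. h i j - mtx_one I i j =
      (\<Sum>(k, l)\<in>I \<times> I. a i k * (g k l - mtx_one I k l) * b l j)"
    using h fin by (auto simp: superclass_iff)
  have one: "mtx_one I k l = mtx_one C k l" if "k \<in> C" "l \<in> C" for k l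
    using that C by (auto simp: mtx_one_def)
  have "block C h i j - mtx_one C i j =
      (\<Sum>(k, l)\<in>C \<times> C. block C a i k * (block C g k l - mtx_one C k l) * block C b l j)" for i j
  proof (cases "i \<in> C \<and> j \<in> C")
    case True
    have "block C h i j - mtx_one C i j = h i j - mtx_one I i j"
      using True by (simp add: block_def one)
    also have "\<dots> = (\<Sum>(k, l)\<in>C \<times> C. a i k * (g k l - mtx_one I k l) * b l j)"
      unfolding eq
    proof (rule sum.mono_neutral_right)
      show "\<forall>x\<in>I \<times> I - C \<times> C. (case x of (k, l) \<Rightarrow> a i k * (g k l - mtx_one I k l) * b l j) = 0"
      proof (clarify, rule ccontr)
        fix k l assume "\<not> (k \<in> C \<and> l \<in> C)" and nz: "a i k * (g k l - mtx_one I k l) * b l j \<noteq> 0"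
        have "(i, k) \<in> P" "(k, l) \<in> P" "(l, j) \<in> P"
          using nz pattern_group_zero[OF ab(1) P] pattern_group_zero[OF ab(2) P]
            pattern_group_diff_zero[OF g, of k l] by (auto simp: prec_def)
        hence "k \<in> C \<and> l \<in> C"
          using True convex posets_trans[OF P] by blast
        thus False using \<open>\<not> (k \<in> C \<and> l \<in> C)\<close> by blast
      qed
    qed (use fin C in auto)
    also have "\<dots> = (\<Sum>(k, l)\<in>C \<times> C. block C a i k * (block C g k l - mtx_one C k l) * block C b l j)"
      using True by (intro sum.cong) (auto simp: block_def one)
    finally show ?thesis .
  next
    case False
    thus ?thesis by (auto simp: block_def mtx_one_def intro!: sum.neutral[symmetric])
  qed
  moreover have "block C h \<in> pattern_group C (Restr P C)" "block C a \<in> pattern_group C (Restr P C)"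
    "block C b \<in> pattern_group C (Restr P C)"
    using h ab C by (auto simp: superclass_def intro: block_pattern_group)
  ultimately show ?thesis
    unfolding superclass_iff[OF finC] by blast
qed

text \<open>The witnesses \<open>a\<close> and \<open>b\<close> are extended by the identity on T.
  All factors are then block diagonal, and on T the middle one is multiplied by identities.\<close>

lemma superclass_block_sum:
  assumes fin: "finite S" "finite T" and disj: "S \<inter> T = {}"
    and g: "g \<in> superclass S (Restr R S) g\<^sub>0" and h: "h \<in> pattern_group T (Restr R T)"
  shows "block_sum S T g h \<in> superclass (S \<union> T) R (block_sum S T g\<^sub>0 h)"
proof -
  let ?I = "S \<union> T"
  have finI: "finite ?I" using fin by simp
  obtain a b where ab: "a \<in> pattern_group S (Restr R S)" "b \<in> pattern_group S (Restr R S)"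
    and eq: "\<And>i j. g i j - mtx_one S i j =
      (\<Sum>(k, l)\<in>S \<times> S. a i k * (g\<^sub>0 k l - mtx_one S k l) * b l j)"
    using g fin by (auto simp: superclass_iff)
  define a' where "a' = block_sum S T a (mtx_one T)"
  define b' where "b' = block_sum S T b (mtx_one T)"
  define x where "x k l = block_sum S T g\<^sub>0 h k l - mtx_one ?I k l" for k l
  have bs: "block_sum S T u v k l = u k l" if "k \<in> S" "l \<in> S" for u v :: "('a, 'b) mtx" and k l
    using that by (simp add: block_sum_def)
  have bt: "block_sum S T u v k l = v k l" if "k \<in> T" "l \<in> T" for u v :: "('a, 'b) mtx" and k l
    using that disj by (auto simp: block_sum_def)
  have b0: "block_sum S T u v k l = 0" if "\<not> (k \<in> S \<and> l \<in> S)" "\<not> (k \<in> T \<and> l \<in> T)"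
    for u v :: "('a, 'b) mtx" and k l
    using that by (auto simp: block_sum_def)
  have one: "mtx_one ?I k l = block_sum S T (mtx_one S) (mtx_one T) k l" for k l
    by (auto simp: mtx_one_def block_sum_def)
  have x0: "x k l = 0" if "\<not> (k \<in> S \<and> l \<in> S)" "\<not> (k \<in> T \<and> l \<in> T)" for k l
    using that by (simp add: x_def one b0)
  have aT: "a' i k = (if i = k then 1 else 0)" if "i \<in> T" for i k
    using that disj by (auto simp: a'_def block_sum_def mtx_one_def)
  have bT: "b' l j = (if l = j then 1 else 0)" if "j \<in> T" for l j
    using that disj by (auto simp: b'_def block_sum_def mtx_one_def)
  have "block_sum S T g h i j - mtx_one ?I i j = (\<Sum>(k, l)\<in>?I \<times> ?I. a' i k * x k l * b' l j)" for i j
  proof -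
    consider (S) "i \<in> S" "j \<in> S" | (T) "i \<in> T" "j \<in> T"
      | (0) "\<not> (i \<in> S \<and> j \<in> S)" "\<not> (i \<in> T \<and> j \<in> T)" by blast
    thus ?thesis
    proof cases
      case S
      have "block_sum S T g h i j - mtx_one ?I i j =
          (\<Sum>(k, l)\<in>S \<times> S. a i k * (g\<^sub>0 k l - mtx_one S k l) * b l j)"
        using S by (simp add: one bs eq)
      also have "\<dots> = (\<Sum>(k, l)\<in>S \<times> S. a' i k * x k l * b' l j)"
        using S by (intro sum.cong) (auto simp: a'_def b'_def x_def one bs)
      also have "\<dots> = (\<Sum>(k, l)\<in>?I \<times> ?I. a' i k * x k l * b' l j)"
      proof (rule sum.mono_neutral_left)
        have "i \<notin> T" "j \<notin> T" using S disj by auto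
        hence "a' i k = 0" if "k \<notin> S" for k
          using that by (simp add: a'_def b0)
        moreover have "b' l j = 0" if "l \<notin> S" for l
          using that \<open>j \<notin> T\<close> by (simp add: b'_def b0)
        ultimately have zero: "a' i k * x k l * b' l j = 0" if "\<not> (k \<in> S \<and> l \<in> S)" for k l
          using that by (metis mult_zero_left mult_zero_right)
        show "\<forall>y\<in>?I \<times> ?I - S \<times> S. (case y of (k, l) \<Rightarrow> a' i k * x k l * b' l j) = 0"
        proof
          fix y assume "y \<in> ?I \<times> ?I - S \<times> S"
          then obtain k l where "y = (k, l)" "\<not> (k \<in> S \<and> l \<in> S)" by (cases y) blast
          thus "(case y of (k, l) \<Rightarrow> a' i k * x k l * b' l j) = 0"
            using zero by (simp only: prod.case)
        qed
      qed (use fin in auto)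
      finally show ?thesis .
    next
      case T
      have "(\<Sum>(k, l)\<in>?I \<times> ?I. a' i k * x k l * b' l j) =
          (\<Sum>y\<in>?I \<times> ?I. if y = (i, j) then x i j else 0)"
        using T by (intro sum.cong) (auto simp: aT bT split: if_splits)
      also have "\<dots> = x i j"
        using T fin by simp
      finally show ?thesis using T by (simp add: x_def one bt)
    next
      \<comment> \<open>A nonzero term would put i and k, then k and l, then l and j into a common
        block, hence i and j too.\<close>
      case 0
      have "a' i k * x k l * b' l j = 0" for k l
        using 0 b0[of i k a "mtx_one T"] b0[of l j b "mtx_one T"] x0[of k l] disj
        unfolding a'_def[symmetric] b'_def[symmetric] by fastforce
      hence "(\<Sum>(k, l)\<in>?I \<times> ?I. a' i k * x k l * b' l j) = 0"
        by (simp add: case_prod_unfold del: mult_eq_0_iff)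
      thus ?thesis using 0 by (simp add: one b0)
    qed
  qed
  moreover have "a' \<in> pattern_group ?I R" "b' \<in> pattern_group ?I R"
    "block_sum S T g h \<in> pattern_group ?I R"
    using ab g h disj unfolding a'_def b'_def superclass_def
    by (auto intro!: block_sum_pattern_group)
  ultimately show ?thesis
    unfolding superclass_iff[OF finI] x_def by blast
qed

text \<open>The common representative \<open>g\<close> copies the quantifiers of \<open>scf\<close>,
  which thereby becomes an instance of \<open>invariant_funs\<close>.\<close>

definition superclass_rel ::
  "'a set \<Rightarrow> 'a rel \<Rightarrow> ('a, 'k::field) mtx \<Rightarrow> ('a, 'k) mtx \<Rightarrow> bool" where
  "superclass_rel I P h h' \<longleftrightarrow>
     (\<exists>g\<in>pattern_group I P. h \<in> superclass I P g \<and> h' \<in> superclass I P g)"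

lemma superclass_pattern_relation:
  "pattern_relation (superclass_rel :: _ \<Rightarrow> _ \<Rightarrow> ('a, 'k::{field,finite}) mtx \<Rightarrow> _)"
proof
  fix I P and \<sigma> :: "'a \<Rightarrow> 'a" and g h :: "('a, 'k) mtx"
  assume "finite I" "inj_on \<sigma> I" "superclass_rel (\<sigma> ` I) P g h"
  thus "superclass_rel I (pullback I \<sigma> P) (relabel_mtx I \<sigma> g) (relabel_mtx I \<sigma> h)"
    unfolding superclass_rel_def using relabel_pattern_group superclass_relabel by blast
next
  fix I C and P :: "'a rel" and g h :: "('a, 'k) mtx"
  assume *: "finite I" "P \<in> posets I" "C \<subseteq> I"
    "\<And>i j k. i \<in> C \<Longrightarrow> j \<in> C \<Longrightarrow> (i, k) \<in> P \<Longrightarrow> (k, j) \<in> P \<Longrightarrow> k \<in> C"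
  have "block C x \<in> superclass C (Restr P C) (block C y)"
    if "y \<in> pattern_group I P" "x \<in> superclass I P y" for x y :: "('a, 'k) mtx"
    using * that by (rule superclass_block)
  moreover assume "superclass_rel I P g h"
  ultimately show "superclass_rel C (Restr P C) (block C g) (block C h)"
    unfolding superclass_rel_def using block_pattern_group[OF _ *(3)] by blast
next
  fix S T and R :: "'a rel" and g g' h :: "('a, 'k) mtx"
  assume "finite S" "finite T" "S \<inter> T = {}" "h \<in> pattern_group T (Restr R T)"
    "superclass_rel S (Restr R S) g g'"
  thus "superclass_rel (S \<union> T) R (block_sum S T g h) (block_sum S T g' h)"
    unfolding superclass_rel_def using block_sum_pattern_group superclass_block_sum by blast
qed


section \<open>Nonnesting superclasses are unions of superclasses\<close>

text \<open>A surviving term has i \<preceq> k \<prec> l \<preceq> j, where \<open>g\<close>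
  vanishes except possibly at (i, j); that term carries the diagonal entries
  \<open>a i i = 1\<close> and \<open>b j j = 1\<close>. Since \<open>g i j\<close> may be zero, the
  lemma transfers zeros as well as labels.\<close>

lemma superclass_entry:
  assumes fin: "finite I" and P: "P \<in> posets I" and g: "g \<in> pattern_group I P"
    and h: "h \<in> superclass I P g" and ij: "prec P i j" and zero: "inner_zero P g i j"
  shows "h i j = g i j"
proof -
  obtain a b where ab: "a \<in> pattern_group I P" "b \<in> pattern_group I P"
    and eq: "\<And>i j. h i j - mtx_one I i j =
      (\<Sum>(k, l)\<in>I \<times> I. a i k * (g k l - mtx_one I k l) * b l j)"
    using h fin by (auto simp: superclass_iff)
  have dom: "i \<in> I" "j \<in> I" using ij posets_dom[OF P] by (auto simp: prec_def)
  have one: "mtx_one I k l = 0" if "prec P k l" for k l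
    using that by (simp add: prec_def mtx_one_def)
  have "h i j - mtx_one I i j =
      (\<Sum>(k, l)\<in>{(i, j)}. a i k * (g k l - mtx_one I k l) * b l j)"
    unfolding eq
  proof (rule sum.mono_neutral_right)
    show "\<forall>x\<in>I \<times> I - {(i, j)}. (case x of (k, l) \<Rightarrow> a i k * (g k l - mtx_one I k l) * b l j) = 0"
    proof (clarify, rule ccontr)
      fix k l assume ne: "\<not> (k = i \<and> l = j)"
        and nz: "a i k * (g k l - mtx_one I k l) * b l j \<noteq> 0"
      have kl: "(i, k) \<in> P" "prec P k l" "(l, j) \<in> P"
        using nz pattern_group_zero[OF ab(1) P] pattern_group_zero[OF ab(2) P]
          pattern_group_diff_zero[OF g, of k l] by auto
      hence "g k l = 0" using ne by (intro inner_zeroD[OF zero]) auto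
      thus False using nz one[OF kl(2)] by auto
    qed
  qed (use fin dom in auto)
  thus ?thesis
    using dom by (simp add: one[OF ij] pattern_group_diag[OF ab(1)] pattern_group_diag[OF ab(2)])
qed

text \<open>Once both matrices are known to have the same inner zeros at every position, their
  minimal entries agree by \<open>superclass_entry\<close>.\<close>

lemma superclass_sml:
  assumes fin: "finite I" and P: "P \<in> posets I" and g: "g \<in> pattern_group I P"
    and h: "h \<in> superclass I P g"
  shows "sml P h = sml P g"
proof -
  have zero_iff: "inner_zero P h i j \<longleftrightarrow> inner_zero P g i j" for i j
  proof
    assume zero: "inner_zero P g i j"
    show "inner_zero P h i j"
      unfolding inner_zero_def
    proof (intro allI impI, elim conjE)
      fix k l assume kl: "(k, l) \<noteq> (i, j)" "(i, k) \<in> P" "prec P k l" "(l, j) \<in> P"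
      \<comment> \<open>The zeros are inherited by the subinterval, so
        \<open>superclass_entry\<close> applies at (k, l) itself and copies the zero to
        \<open>h\<close>.\<close>
      have "inner_zero P g k l"
        using inner_zero_subinterval[OF P zero kl(1,2) _ kl(4)] kl(3) by (simp add: prec_def)
      thus "h k l = 0"
        using superclass_entry[OF fin P g h kl(3)] inner_zeroD[OF zero kl] by simp
    qed
  next
    assume zero: "inner_zero P h i j"
    show "inner_zero P g i j"
      unfolding inner_zero_def
    proof (intro allI impI, elim conjE, rule ccontr)
      fix k l assume kl: "(k, l) \<noteq> (i, j)" "(i, k) \<in> P" "prec P k l" "(l, j) \<in> P" "g k l \<noteq> 0"
      \<comment> \<open>\<open>superclass_entry\<close> may fail to apply at (k, l), whose interval
        can contain further nonzero entries of \<open>g\<close>. It does apply at a smallest one,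
        which \<open>h\<close> therefore shares.\<close>
      obtain k' l' where *: "(k, k') \<in> P" "(l', l) \<in> P" "(k', g k' l', l') \<in> sml P g"
        by (rule sml_exists[where g = g, OF fin P kl(3) kl(5)])
      hence kl': "prec P k' l'" "h k' l' \<noteq> 0"
        using superclass_entry[OF fin P g h] by (auto simp: sml_iff)
      have "(k', l') \<noteq> (i, j)"
        using kl * posets_antisym[OF P] by blast
      moreover have "(i, k') \<in> P" "(l', j) \<in> P"
        using kl * posets_trans[OF P] by blast+
      ultimately show False
        using inner_zeroD[OF zero _ _ kl'(1)] kl'(2) by blast
    qed
  qed
  show ?thesis
    by (rule sml_eqI) (use zero_iff superclass_entry[OF fin P g h] in \<open>auto simp: sml_iff\<close>)
qed

lemma nnf_subset_scf:
  assumes "finite I" "P \<in> posets I"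
  shows "nnf I P \<subseteq> scf I P"
proof
  fix \<alpha> :: "('a, 'b) mtx \<Rightarrow> complex"
  assume \<alpha>: "\<alpha> \<in> nnf I P"
  have "\<alpha> h = \<alpha> h'" if "g \<in> pattern_group I P" "h \<in> superclass I P g" "h' \<in> superclass I P g" for g h h'
  proof -
    have "sml P h = sml P h'" using that superclass_sml[OF assms] by metis
    moreover have "h \<in> pattern_group I P" "h' \<in> pattern_group I P"
      using that by (auto simp: superclass_def)
    ultimately show ?thesis using \<alpha> unfolding nnf_def by blast
  qed
  thus "\<alpha> \<in> scf I P" using \<alpha> unfolding nnf_def scf_def by blast
qed

theorem proposition7p4:
  shows "hopf_submonoid
    (nnfp :: 'a set \<Rightarrow> ('a, 'k::{field,finite}) pvec set)
    (scfp :: 'a set \<Rightarrow> ('a, 'k) pvec set)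
    fp_act fp_unit fp_mult fp_comult"
proof -
  have "nnf = invariant_funs (\<lambda>_ P g h. sml P g = sml P (h :: ('a, 'k) mtx))"
    by (simp add: fun_eq_iff nnf_def invariant_funs_def)
  hence nnfp: "nnfp = (\<lambda>I. poset_sum I (invariant_funs (\<lambda>_ P g h. sml P g = sml P (h :: ('a, 'k) mtx)) I))"
    by (intro ext) (simp only: nnfp_def)
  \<comment> \<open>Membership in \<open>superclass\<close> includes membership in the pattern
    group, so the quantifiers over \<open>h\<close> and \<open>h'\<close> match those of
    \<open>invariant_funs\<close>.\<close>
  have "scf = invariant_funs (superclass_rel :: _ \<Rightarrow> _ \<Rightarrow> ('a, 'k) mtx \<Rightarrow> _)"
    unfolding fun_eq_iff scf_def invariant_funs_def superclass_rel_def superclass_def by blast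
  hence scfp: "scfp = (\<lambda>I. poset_sum I (invariant_funs (superclass_rel :: _ \<Rightarrow> _ \<Rightarrow> ('a, 'k) mtx \<Rightarrow> _) I))"
    by (intro ext) (simp only: scfp_def)
  have "nnfp I \<subseteq> (scfp I :: ('a, 'k) pvec set)" if "finite I" for I
    unfolding nnfp_def scfp_def poset_sum_def using nnf_subset_scf[OF that] by blast
  thus ?thesis
    unfolding hopf_submonoid_def
    using pattern_relation.hopf_monoid_pvecs[OF sml_pattern_relation]
      pattern_relation.hopf_monoid_pvecs[OF superclass_pattern_relation]
    unfolding nnfp scfp by blast
qed

end
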